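(* Suppose that $m=-(\tfrac12+k)$, $k\in\mathbb{Z}_{\ge0}$, and let $T=T_{\delta_1,\delta_2}$ with $\delta_1,\delta_2>0$ sufficiently small. The zeros and poles of the piecewise-meromorphic approximating function $\dot u_n$ on $T$ lie on a system of $4k+2$ non-intersecting curves roughly parallel to the eyebrow $\partial E^\infty$. With $v(y):=\mathrm{Re}(V(p(y)^{-1};y))$ and $p=p(y)$, from left to right these are: - a curve of poles, given in the sub-domain $v(y)\le-\frac12(k-\frac12)\frac{\ln n}{n}$ by $$\mathrm{e}^{2nv(y)}=\frac{k!\,|p^{-1}+p|^k}{n^k|p^{-1}-p|^{3k}}|p|;$$ - a curve of zeros, given in the same sub-domain by $$\mathrm{e}^{2nv(y)}=\frac{k!\,|p^{-1}+p|^k}{n^k|p^{-1}-p|^{3k}}|p|^{-1};$$ - for $\ell=1,\dots,k$: - a curve of zeros, given in $-\frac12(k-2\ell+\frac32)\frac{\ln n}{n}\le v(y)\le-\frac12(k-2\ell+\frac12)\frac{\ln n}{n}$ by $$\mathrm{e}^{2nv(y)}=\frac{(k-\ell)!\,|p^{-1}+p|^{k-2\ell+1}}{(\ell-1)!\,n^{k-2\ell+1}|p^{-1}-p|^{3k-6\ell+3}}|p|;$$ - a curve of poles, given in the same sub-domain by $$\mathrm{e}^{2nv(y)}=\frac{(k-\ell)!\,|p^{-1}+p|^{k-2\ell+1}}{(\ell-1)!\,n^{k-2\ell+1}|p^{-1}-p|^{3k-6\ell+3}}|p|^{-1};$$ - a curve of poles, given in $-\frac12(k-2\ell+\frac12)\frac{\ln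 n}{n}\le v(y)\le-\frac12(k-2\ell-\frac12)\frac{\ln n}{n}$ by $$\mathrm{e}^{2nv(y)}=\frac{(k-\ell)!\,|p^{-1}+p|^{k-2\ell}}{\ell!\,n^{k-2\ell}|p^{-1}-p|^{3k-6\ell}}|p|;$$ - a curve of zeros, given in the same sub-domain by $$\mathrm{e}^{2nv(y)}=\frac{(k-\ell)!\,|p^{-1}+p|^{k-2\ell}}{\ell!\,n^{k-2\ell}|p^{-1}-p|^{3k-6\ell}}|p|^{-1}.$$ (In the terminal case $\ell=k\geq 1$ the last two formulae also apply in the right-most sub-domain $v(y)\ge\frac12(k+\frac12)\frac{\ln n}{n}$; if $k=0$ the first two formulae apply on all of $T$.) Analogous results hold for the approximation to $u_n(ny;m)$ for $m=\frac12+k$, $k\in\mathbb{Z}_{\ge0}$, obtained from $\dot u_n$ via the symmetry $u_n(-x;m)=1/u_n(x;-m)$ (i.e., $y\mapsto-y$, $m\mapsto-m$, $\dot u_n\mapsto\dot u_n^{-1}$).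
   Context: For $n\in\mathbb{Z}$ and $m\in\mathbb{C}$, $u_n(x;m)$ denotes the unique rational solution $u(x)$ of the Painlev\'e-III equation $$u''=\frac{(u')^2}{u}-\frac{u'}{x}+\frac{4\Theta_0u^2+4(1-\Theta_\infty)}{x}+4u^3-\frac4u,\qquad \Theta_0=n+m,\quad \Theta_\infty=m-n+1,$$ that tends to $1$ as $x\to\infty$. $p(y):=\frac{\mathrm{i}}{2y}-\mathrm{i}\sqrt{\frac{1}{4y^2}+1}$, where the square root equals $1$ at $y=\infty$ and is analytic except on the segment of the imaginary axis joining $y=\pm\frac12\mathrm{i}$. $V(\lambda;y):=-\log(\lambda)-\mathrm{i}y(\lambda-\lambda^{-1})$; $\mathrm{Re}(V)$ and $\mathrm{e}^{2nV}$ ($n\in\mathbb{Z}$) are single-valued. The right eyebrow $\partial E^\infty$ is the closure of the arc in the open right half-plane, joining $\pm\frac12\mathrm{i}$, along which $\mathrm{Re}(V(p(y);y))=0$. For sufficiently small positive constants $\delta_1,\delta_2$, $$T=T_{\delta_1,\delta_2}:=\Big\{y\in\mathbb{C}:\ |\arg(y)|\le\tfrac{\pi}{2}-\delta_1,\ |\mathrm{Re}(V(p(y);y))|\le\delta_2\Big\}.$$ Given $k\in\mathbb{Z}_{\ge0}$, put, with $p=p(y)$, $$U_{n,j}(y):=\mathrm{i}\,p\,\frac{\mathrm{e}^{2nV(p^{-1};y)}-p^{-1}G_{n,j}(y)}{\mathrm{e}^{2nV(p^{-1};y)}-p\,G_{n,j}(y)},\qquad G_{n,j}(y):=\mathrm{i}(-1)^jn^{2j-k}\frac{(k-j)!}{j!}(p^{-1}+p)^{k-2j}(p^{-1}-p)^{6j-3k},\quad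 0\le j\le k,$$ $$W_{n,\ell}(y):=\mathrm{i}\,p^{-1}\,\frac{\mathrm{e}^{2nV(p^{-1};y)}-p\,F_{n,\ell}(y)}{\mathrm{e}^{2nV(p^{-1};y)}-p^{-1}F_{n,\ell}(y)},\qquad F_{n,\ell}(y):=\mathrm{i}(-1)^\ell n^{2\ell-k-1}\frac{(k-\ell)!}{(\ell-1)!}(p^{-1}+p)^{k-2\ell+1}(p^{-1}-p)^{6\ell-3k-3},\quad 1\le\ell\le k.$$ The function $\dot u_n=\dot u_n(y)$ (the approximation of $u_n(ny;-(\frac12+k))$ on $T$) is defined layer by layer, with $v(y)=\mathrm{Re}(V(p(y)^{-1};y))$: - $\dot u_n=U_{n,0}$ if $v(y)\le-\frac12k\frac{\ln n}{n}$; - for $\ell=1,\dots,k$: $\dot u_n=U_{n,\ell-1}$ if $-\frac12(k-2\ell+2)\frac{\ln n}{n}\le v(y)\le-\frac12(k-2\ell+\frac32)\frac{\ln n}{n}$; $\dot u_n=W_{n,\ell}$ if $-\frac12(k-2\ell+\frac32)\frac{\ln n}{n}\le v(y)\le-\frac12(k-2\ell+\frac12)\frac{\ln n}{n}$; $\dot u_n=U_{n,\ell}$ if $-\frac12(k-2\ell+\frac12)\frac{\ln n}{n}\le v(y)\le-\frac12(k-2\ell)\frac{\ln n}{n}$; - $\dot u_n=U_{n,k}$ if $v(y)\ge\frac12k\frac{\ln n}{n}$. "Left to right" refers to crossing $\partial E^\infty$ from inside the eye to outside, i.e., in the direction of increasing $v(y)$. *)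

theory Defs
  imports "HOL-Complex_Analysis.Complex_Analysis"
begin

(* The principal root is the required branch: 1/(4 y^2) + 1 is a non-positive real exactly
   on the segment joining -i/2 and i/2. *)
definition pfun :: "complex \<Rightarrow> complex" where
  "pfun y = \<i> / (2 * y) - \<i> * csqrt (1 / (4 * y ^ 2) + 1)"

(* Only Re (Vfun l y) and exp (2 n Vfun l y) for integer n are used; they do not depend on
   the branch of the logarithm. *)
definition Vfun :: "complex \<Rightarrow> complex \<Rightarrow> complex" where
  "Vfun l y = - Ln l - \<i> * y * (l - inverse l)"

definition vfun :: "complex \<Rightarrow> real" where
  "vfun y = Re (Vfun (inverse (pfun y)) y)"

definition right_eyebrow :: "complex set" where
  "right_eyebrow = closure {y. Re y > 0 \<and> Re (Vfun (pfun y) y) = 0}"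

(* y = 0 is excluded explicitly because Arg 0 = 0 and division by 0 is total. *)
definition Tset :: "real \<Rightarrow> real \<Rightarrow> complex set" where
  "Tset d1 d2 = {y. y \<noteq> 0 \<and> \<bar>Arg y\<bar> \<le> pi / 2 - d1 \<and> \<bar>Re (Vfun (pfun y) y)\<bar> \<le> d2}"

definition expV :: "nat \<Rightarrow> complex \<Rightarrow> complex" where
  "expV n y = exp (2 * of_nat n * Vfun (inverse (pfun y)) y)"

definition Gfun :: "nat \<Rightarrow> nat \<Rightarrow> nat \<Rightarrow> complex \<Rightarrow> complex" where
  "Gfun k n j y = \<i> * (-1) ^ j * of_nat n powi (2 * int j - int k)
     * (fact (k - j) / fact j)
     * (inverse (pfun y) + pfun y) powi (int k - 2 * int j)
     * (inverse (pfun y) - pfun y) powi (6 * int j - 3 * int k)"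

definition Ffun :: "nat \<Rightarrow> nat \<Rightarrow> nat \<Rightarrow> complex \<Rightarrow> complex" where
  "Ffun k n l y = \<i> * (-1) ^ l * of_nat n powi (2 * int l - int k - 1)
     * (fact (k - l) / fact (l - 1))
     * (inverse (pfun y) + pfun y) powi (int k - 2 * int l + 1)
     * (inverse (pfun y) - pfun y) powi (6 * int l - 3 * int k - 3)"

definition Ufun :: "nat \<Rightarrow> nat \<Rightarrow> nat \<Rightarrow> complex \<Rightarrow> complex" where
  "Ufun k n j y = \<i> * pfun y
     * ((expV n y - inverse (pfun y) * Gfun k n j y) / (expV n y - pfun y * Gfun k n j y))"

definition Wfun :: "nat \<Rightarrow> nat \<Rightarrow> nat \<Rightarrow> complex \<Rightarrow> complex" where
  "Wfun k n l y = \<i> * inverse (pfun y)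
     * ((expV n y - pfun y * Ffun k n l y) / (expV n y - inverse (pfun y) * Ffun k n l y))"

definition lev :: "nat \<Rightarrow> real \<Rightarrow> real" where
  "lev n c = - (1 / 2) * c * (ln (real n) / real n)"

(* A piecewise meromorphic function is represented by its pieces (D, f): on the closed
   region D it is given by the formula f.  Neighbouring regions share their boundary, where
   both formulas are admitted; a zero or pole of either one counts there. *)
type_synonym pieces = "(complex set \<times> (complex \<Rightarrow> complex)) set"

definition pw_zero :: "pieces \<Rightarrow> complex \<Rightarrow> bool" where
  "pw_zero P y \<longleftrightarrow> (\<exists>(D, f)\<in>P. y \<in> D \<and> isolated_zero f y)"

definition pw_pole :: "pieces \<Rightarrow> complex \<Rightarrow> bool" where
  "pw_pole P y \<longleftrightarrow> (\<exists>(D, f)\<in>P. y \<in> D \<and> is_pole f y)"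

definition udot :: "nat \<Rightarrow> nat \<Rightarrow> pieces" where
  "udot k n =
     {({y. vfun y \<le> lev n (real k)}, Ufun k n 0),
      ({y. vfun y \<ge> lev n (- real k)}, Ufun k n k)}
     \<union> (\<Union>l\<in>{1..k}.
         {({y. lev n (real k - 2 * real l + 2) \<le> vfun y
               \<and> vfun y \<le> lev n (real k - 2 * real l + 3 / 2)}, Ufun k n (l - 1)),
          ({y. lev n (real k - 2 * real l + 3 / 2) \<le> vfun y
               \<and> vfun y \<le> lev n (real k - 2 * real l + 1 / 2)}, Wfun k n l),
          ({y. lev n (real k - 2 * real l + 1 / 2) \<le> vfun y
               \<and> vfun y \<le> lev n (real k - 2 * real l)}, Ufun k n l)})"

(* The image of a function u under the symmetry y -> -y, u -> 1/u: this turns the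
   approximation for m = -(1/2 + k) into the one for m = 1/2 + k. *)
definition reflect_pieces :: "pieces \<Rightarrow> pieces" where
  "reflect_pieces P = (\<lambda>(D, f). (uminus ` D, \<lambda>y. inverse (f (- y)))) ` P"

definition Udom :: "nat \<Rightarrow> nat \<Rightarrow> nat \<Rightarrow> complex set" where
  "Udom k n l =
     (if l = 0 then {y. k = 0 \<or> vfun y \<le> lev n (real k - 1 / 2)}
      else {y. lev n (real k - 2 * real l + 1 / 2) \<le> vfun y
               \<and> vfun y \<le> lev n (real k - 2 * real l - 1 / 2)
             \<or> l = k \<and> vfun y \<ge> (1 / 2) * (real k + 1 / 2) * (ln (real n) / real n)})"

definition Wdom :: "nat \<Rightarrow> nat \<Rightarrow> nat \<Rightarrow> complex set" where
  "Wdom k n l = {y. lev n (real k - 2 * real l + 3 / 2) \<le> vfun y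
                    \<and> vfun y \<le> lev n (real k - 2 * real l + 1 / 2)}"

definition Ulevel :: "nat \<Rightarrow> nat \<Rightarrow> nat \<Rightarrow> complex \<Rightarrow> real" where
  "Ulevel k n l y =
     fact (k - l) * cmod (inverse (pfun y) + pfun y) powi (int k - 2 * int l)
     / (fact l * real n powi (int k - 2 * int l)
        * cmod (inverse (pfun y) - pfun y) powi (3 * int k - 6 * int l))"

definition Wlevel :: "nat \<Rightarrow> nat \<Rightarrow> nat \<Rightarrow> complex \<Rightarrow> real" where
  "Wlevel k n l y =
     fact (k - l) * cmod (inverse (pfun y) + pfun y) powi (int k - 2 * int l + 1)
     / (fact (l - 1) * real n powi (int k - 2 * int l + 1)
        * cmod (inverse (pfun y) - pfun y) powi (3 * int k - 6 * int l + 3))"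

datatype kind = Zeros | Poles

fun swap_kind :: "kind \<Rightarrow> kind" where
  "swap_kind Zeros = Poles"
| "swap_kind Poles = Zeros"

(* The curves inside T, listed from left to right, each with the kind of points it carries. *)
definition curves :: "complex set \<Rightarrow> nat \<Rightarrow> nat \<Rightarrow> (kind \<times> complex set) list" where
  "curves T k n =
     [(Poles, {y \<in> T. y \<in> Udom k n 0
                 \<and> exp (2 * real n * vfun y) = Ulevel k n 0 y * cmod (pfun y)}),
      (Zeros, {y \<in> T. y \<in> Udom k n 0
                 \<and> exp (2 * real n * vfun y) = Ulevel k n 0 y * inverse (cmod (pfun y))})]
     @ concat (map (\<lambda>l.
       [(Zeros, {y \<in> T. y \<in> Wdom k n l
                   \<and> exp (2 * real n * vfun y) = Wlevel k n l y * cmod (pfun y)}),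
        (Poles, {y \<in> T. y \<in> Wdom k n l
                   \<and> exp (2 * real n * vfun y) = Wlevel k n l y * inverse (cmod (pfun y))}),
        (Poles, {y \<in> T. y \<in> Udom k n l
                   \<and> exp (2 * real n * vfun y) = Ulevel k n l y * cmod (pfun y)}),
        (Zeros, {y \<in> T. y \<in> Udom k n l
                   \<and> exp (2 * real n * vfun y) = Ulevel k n l y * inverse (cmod (pfun y))})])
       [1..<Suc k])"

definition reflect_curves :: "(kind \<times> complex set) list \<Rightarrow> (kind \<times> complex set) list" where
  "reflect_curves cs = map (\<lambda>(K, c). (swap_kind K, uminus ` c)) cs"

definition zeros_poles_lie_on ::
    "pieces \<Rightarrow> complex set \<Rightarrow> (kind \<times> complex set) list \<Rightarrow> bool" where
  "zeros_poles_lie_on P T cs \<longleftrightarrow>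
     (\<forall>y\<in>T. (pw_zero P y \<longrightarrow> (\<exists>c. (Zeros, c) \<in> set cs \<and> y \<in> c))
           \<and> (pw_pole P y \<longrightarrow> (\<exists>c. (Poles, c) \<in> set cs \<and> y \<in> c)))"

(* cs is a list of pairwise disjoint arcs that cross each ray r * d t (r > 0), for t in the
   parameter set A, exactly once, in the order of the list going outwards, which is also the
   direction of increasing w.  "Roughly parallel" to the level curve w = 0 called E: along
   each arc w has Lipschitz constant at most eps in t (so that the arc is nearly a level curve
   of w), and the arc stays within distance eta of E. *)
definition ordered_parallel_arcs ::
    "(complex \<Rightarrow> real) \<Rightarrow> complex set \<Rightarrow> (real \<Rightarrow> complex) \<Rightarrow> real set \<Rightarrow> real \<Rightarrow> real
      \<Rightarrow> complex set list \<Rightarrow> bool" where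
  "ordered_parallel_arcs w E d A eta eps cs \<longleftrightarrow>
     (\<forall>i j. i < j \<and> j < length cs \<longrightarrow> cs ! i \<inter> cs ! j = {}) \<and>
     (\<exists>r :: nat \<Rightarrow> real \<Rightarrow> real.
        (\<forall>i<length cs. continuous_on A (r i) \<and> (\<forall>t\<in>A. r i t > 0)
            \<and> cs ! i = (\<lambda>t. of_real (r i t) * d t) ` A) \<and>
        (\<forall>i j. i < j \<and> j < length cs \<longrightarrow>
            (\<forall>t\<in>A. r i t < r j t
               \<and> w (of_real (r i t) * d t) < w (of_real (r j t) * d t))) \<and>
        (\<forall>i<length cs. \<forall>s\<in>A. \<forall>t\<in>A.
            \<bar>w (of_real (r i s) * d s) - w (of_real (r i t) * d t)\<bar> \<le> eps * \<bar>s - t\<bar>)) \<and>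
     (\<forall>i<length cs. \<forall>y\<in>cs ! i. infdist y E \<le> eta)"

end

theory Submission
  imports Defs
begin

text \<open>
  The root \<open>X = sqrt (y\<^sup>2 + 1 / 4)\<close> brings the functions of the statement into a simple form. In
  the right half-plane \<open>p = (\<i> / y) * (1 / 2 - X)\<close> and \<open>1 / p = (\<i> / y) * (1 / 2 + X)\<close>, and \<open>v\<close> is the
  real part of the holomorphic function \<open>Ln y - Ln (1 / 2 + X) + 2 * X\<close>, whose derivative is
  \<open>2 * X / y\<close>. Since \<open>Re X \<ge> Re y\<close>, the function \<open>v\<close> grows along every ray of argument \<open>t\<close> at
  rate at least \<open>2 * cos t\<close> (\<open>vfun_increase\<close>). A ray therefore meets each level of \<open>v\<close> exactly once,
  and \<open>T\<close> is a strip around the eyebrow that lies between two positive radii.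

  Zeros and poles: a zero of one of the quotients \<open>Ufun\<close>, \<open>Wfun\<close> is a zero of its numerator, and a
  pole is a zero of its denominator, since all functions involved are continuous. Such a point
  satisfies an equation between \<open>expV n y\<close> and an explicit complex number; passing to absolute
  values gives the equation of one of the curves. This holds for every \<open>n \<ge> 1\<close>
  (\<open>zeros_poles_lie_on_curves\<close>).

  Geometry: taking logarithms, the equation of each curve becomes
  \<open>v = - (k - j) * ln n / (2 * n) + h / (2 * n)\<close>, where \<open>j = 0, ..., 2 * k\<close> numbers the sub-domains
  and \<open>h\<close>, the real part of a holomorphic function, does not depend on \<open>n\<close>. On the strip, \<open>h\<close> is
  bounded and Lipschitz. For large \<open>n\<close> the difference of the two sides still increases along rays,
  so the curve is a graph over the argument, at distance of order \<open>ln n / n\<close> from the eyebrow; and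
  along it \<open>v\<close> has Lipschitz constant of order \<open>1 / n\<close>, because there \<open>v\<close> varies only through
  \<open>h / (2 * n)\<close> (\<open>perturbed_levels_ordered_parallel\<close>). Curves from different sub-domains are ordered
  because the spacing \<open>ln n / (2 * n)\<close> of the levels dominates the contributions of \<open>h\<close>, and the two
  curves in one sub-domain are ordered because they differ by the sign of \<open>ln \<bar>p\<bar> < 0\<close>
  (\<open>curves_ordered_parallel\<close>).

  The results for \<open>m = 1 / 2 + k\<close> follow by transport along the reflection \<open>y \<mapsto> - y\<close>, which
  composed with inversion interchanges zeros and poles.
\<close>


section \<open>The functions p and v in the right half-plane\<close>

text \<open>This root uniformises \<open>pfun\<close>: in the right half-plane both \<open>pfun\<close> and its inverse are
  rational in \<open>y\<close> and \<open>yroot y\<close>, and \<open>yroot\<close> is holomorphic there, although \<open>pfun\<close> itself is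
  defined through a root that is singular at the origin.\<close>
definition yroot :: "complex \<Rightarrow> complex" where
  "yroot y = csqrt (y\<^sup>2 + 1 / 4)"

lemma yroot_radicand:
  assumes "Re y > 0"
  shows "y\<^sup>2 + 1 / 4 \<notin> \<real>\<^sub>\<le>\<^sub>0"
proof
  assume "y\<^sup>2 + 1 / 4 \<in> \<real>\<^sub>\<le>\<^sub>0"
  hence "Re (y\<^sup>2 + 1 / 4) \<le> 0" "Im (y\<^sup>2 + 1 / 4) = 0"
    by (auto simp: complex_nonpos_Reals_iff)
  hence "(Re y)\<^sup>2 + 1 / 4 \<le> (Im y)\<^sup>2" "Re y * Im y = 0"
    by (auto simp: power2_eq_square)
  with assms show False
    by (auto simp: power2_eq_square) (metis add_pos_pos mult_pos_pos not_le zero_less_divide_1_iff zero_less_numeral)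
qed

lemma yroot_square: "(yroot y)\<^sup>2 = y\<^sup>2 + 1 / 4"
  by (simp add: yroot_def)

lemma Re_yroot_pos:
  assumes "Re y > 0"
  shows "Re (yroot y) > 0"
proof -
  have "Re (yroot y) \<noteq> 0"
  proof
    assume "Re (yroot y) = 0"
    hence "Re ((yroot y)\<^sup>2) \<le> 0" "Im ((yroot y)\<^sup>2) = 0"
      by (simp_all add: Re_power2 Im_power2)
    with yroot_radicand[OF assms] show False
      by (simp add: yroot_square complex_nonpos_Reals_iff)
  qed
  with Re_csqrt[of "y\<^sup>2 + 1 / 4"] show ?thesis
    by (simp add: yroot_def)
qed

lemma yroot_components:
  "Re (yroot y) * Im (yroot y) = Re y * Im y"
  "(Re (yroot y))\<^sup>2 - (Im (yroot y))\<^sup>2 = (Re y)\<^sup>2 - (Im y)\<^sup>2 + 1 / 4"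
proof -
  have "Im ((yroot y)\<^sup>2) = Im (y\<^sup>2 + 1 / 4)" "Re ((yroot y)\<^sup>2) = Re (y\<^sup>2 + 1 / 4)"
    by (simp_all add: yroot_square)
  thus "Re (yroot y) * Im (yroot y) = Re y * Im y"
    "(Re (yroot y))\<^sup>2 - (Im (yroot y))\<^sup>2 = (Re y)\<^sup>2 - (Im y)\<^sup>2 + 1 / 4"
    by (simp_all add: Re_power2 Im_power2)
qed

text \<open>The numbers \<open>y\<close> and \<open>yroot y\<close> have the same product of real and imaginary part, while the
  difference of the squares of the two parts is larger by 1/4 for \<open>yroot y\<close>. A smaller real part
  would force a larger imaginary part and could only decrease that difference.\<close>
lemma Re_yroot_ge:
  assumes "Re y > 0"
  shows "Re y \<le> Re (yroot y)"
proof (rule ccontr)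
  assume less: "\<not> Re y \<le> Re (yroot y)"
  have pos: "Re (yroot y) > 0"
    using assms by (rule Re_yroot_pos)
  have "\<bar>Re (yroot y)\<bar> * \<bar>Im y\<bar> \<le> \<bar>Re y\<bar> * \<bar>Im y\<bar>"
    using less pos assms by (intro mult_right_mono) auto
  also have "\<dots> = \<bar>Re (yroot y)\<bar> * \<bar>Im (yroot y)\<bar>"
    by (simp flip: abs_mult add: yroot_components)
  finally have "\<bar>Im y\<bar> \<le> \<bar>Im (yroot y)\<bar>"
    using pos by simp
  hence "(Im y)\<^sup>2 \<le> (Im (yroot y))\<^sup>2"
    by (simp add: abs_le_square_iff)
  moreover have "(Re (yroot y))\<^sup>2 \<le> (Re y)\<^sup>2"
    using less pos assms by (intro power_mono) auto
  ultimately show False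
    using yroot_components(2)[of y] by linarith
qed

text \<open>Both sides square to the same value. The root \<open>yroot y\<close> lies in the same quadrant as \<open>y\<close>, so
  the quotient has positive real part, which singles out the principal branch.\<close>
lemma csqrt_eq_yroot_divide:
  assumes "Re y > 0"
  shows "csqrt (1 / (4 * y ^ 2) + 1) = yroot y / y"
proof (rule csqrt_unique)
  have y: "y \<noteq> 0"
    using assms by auto
  show "(yroot y / y)\<^sup>2 = 1 / (4 * y ^ 2) + 1"
    using y by (simp add: power_divide yroot_square field_simps)
  have pos: "Re (yroot y) > 0"
    using assms by (rule Re_yroot_pos)
  have "Re (yroot y) * (Im (yroot y) * Im y) = Re y * (Im y)\<^sup>2"
    using yroot_components(1)[of y] by (metis mult.assoc power2_eq_square)
  hence "Im (yroot y) * Im y \<ge> 0"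
    using pos assms by (metis less_eq_real_def mult_nonneg_nonneg zero_le_mult_iff zero_le_power2 not_less)
  hence "Re (yroot y) * Re y + Im (yroot y) * Im y > 0"
    using pos assms by (intro add_pos_nonneg) auto
  thus "0 < Re (yroot y / y) \<or> Re (yroot y / y) = 0 \<and> 0 \<le> Im (yroot y / y)"
    using y by (auto simp: Re_divide' intro!: divide_pos_pos)
qed

text \<open>This formula and the next one are the two roots of the quadratic equation
  \<open>p + 1 / p = \<i> / y\<close>.\<close>
lemma pfun_eq:
  assumes "Re y > 0"
  shows "pfun y = \<i> / y * (1 / 2 - yroot y)"
  unfolding pfun_def csqrt_eq_yroot_divide[OF assms] by (simp add: right_diff_distrib)

lemma half_plus_yroot_nonzero:
  assumes "Re y > 0"
  shows "1 / 2 + yroot y \<noteq> 0"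
  using Re_yroot_pos[OF assms] by (auto simp: complex_eq_iff)

lemma inverse_pfun_eq:
  assumes "Re y > 0"
  shows "inverse (pfun y) = \<i> / y * (1 / 2 + yroot y)"
proof (rule inverse_unique)
  have "(1 / 2 - yroot y) * (1 / 2 + yroot y) = - (y\<^sup>2)"
    using yroot_square[of y] by (simp add: algebra_simps power2_eq_square)
  hence "pfun y * (\<i> / y * (1 / 2 + yroot y)) = (\<i> / y)\<^sup>2 * - (y\<^sup>2)"
    unfolding pfun_eq[OF assms] by (simp add: power2_eq_square mult_ac)
  thus "pfun y * (\<i> / y * (1 / 2 + yroot y)) = 1"
    using assms by (auto simp: power_divide)
qed

lemma pfun_nonzero:
  assumes "Re y > 0"
  shows "pfun y \<noteq> 0"
  using inverse_pfun_eq[OF assms] half_plus_yroot_nonzero[OF assms] assms by auto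

lemma pfun_sum:
  assumes "Re y > 0"
  shows "inverse (pfun y) + pfun y = \<i> / y"
  unfolding inverse_pfun_eq[OF assms] unfolding pfun_eq[OF assms]
  by (simp add: algebra_simps)

lemma pfun_diff:
  assumes "Re y > 0"
  shows "inverse (pfun y) - pfun y = 2 * \<i> * yroot y / y"
  unfolding inverse_pfun_eq[OF assms] unfolding pfun_eq[OF assms]
  by (simp add: algebra_simps)

lemma norm_pfun:
  assumes "Re y > 0"
  shows "cmod (pfun y) = cmod y / cmod (1 / 2 + yroot y)"
  using arg_cong[OF inverse_pfun_eq[OF assms], of "\<lambda>z. inverse (cmod z)"]
  by (simp add: norm_mult norm_divide norm_inverse)

lemma ln_norm_pfun:
  assumes "Re y > 0"
  shows "ln (cmod (pfun y)) = ln (cmod y) - ln (cmod (1 / 2 + yroot y))"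
  using assms half_plus_yroot_nonzero[OF assms]
  by (auto simp: norm_pfun[OF assms] ln_div)

lemma vfun_eq_norm_pfun:
  assumes "Re y > 0"
  shows "vfun y = ln (cmod (pfun y)) + 2 * Re (yroot y)"
proof -
  have "\<i> * y * (inverse (pfun y) - pfun y) = - (2 * yroot y)"
    using assms unfolding pfun_diff[OF assms] by auto
  thus ?thesis
    using pfun_nonzero[OF assms]
    by (simp add: vfun_def Vfun_def norm_inverse ln_inverse)
qed

lemma Re_V_pfun:
  assumes "Re y > 0"
  shows "Re (Vfun (pfun y) y) = - vfun y"
proof -
  have "\<i> * y * (pfun y - inverse (pfun y)) = 2 * yroot y"
    using arg_cong[OF pfun_diff[OF assms], of "\<lambda>z. - \<i> * y * z"] assms
    by (auto simp: algebra_simps)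
  thus ?thesis
    using pfun_nonzero[OF assms] vfun_eq_norm_pfun[OF assms] by (simp add: Vfun_def)
qed

lemma norm_pfun_le:
  assumes "Re y > 0"
  shows "cmod (pfun y) \<le> 2 * cmod y"
proof -
  have "1 / 2 \<le> Re (1 / 2 + yroot y)"
    using Re_yroot_pos[OF assms] by simp
  also have "\<dots> \<le> cmod (1 / 2 + yroot y)"
    by (rule complex_Re_le_cmod)
  finally have "cmod y \<le> 2 * cmod y * cmod (1 / 2 + yroot y)"
    using mult_left_mono[of "1 / 2" _ "2 * cmod y"] by simp
  thus ?thesis
    using half_plus_yroot_nonzero[OF assms] by (simp add: norm_pfun[OF assms] divide_le_eq)
qed

text \<open>The strict inequality separates the curve of zeros from the curve of poles that belong to the
  same sub-domain, and it puts the curve with factor \<open>cmod (pfun y)\<close> to the left.\<close>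
lemma norm_pfun_less_1:
  assumes "Re y > 0"
  shows "cmod (pfun y) < 1"
proof -
  have "(cmod y)\<^sup>2 = cmod ((yroot y)\<^sup>2 - 1 / 4)"
    by (simp add: yroot_square flip: norm_power)
  also have "\<dots> \<le> (cmod (yroot y))\<^sup>2 + 1 / 4"
    using norm_triangle_ineq4[of "(yroot y)\<^sup>2" "1 / 4"] by (simp add: norm_power norm_divide)
  also have "\<dots> < (cmod (1 / 2 + yroot y))\<^sup>2"
    unfolding cmod_power2 using Re_yroot_pos[OF assms]
    by (simp add: power2_eq_square algebra_simps)
  finally have "cmod y < cmod (1 / 2 + yroot y)"
    by (rule power_less_imp_less_base) simp
  thus ?thesis
    using half_plus_yroot_nonzero[OF assms] by (simp add: norm_pfun[OF assms])
qed

lemma has_field_derivative_yroot: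
  assumes "Re y > 0"
  shows "(yroot has_field_derivative y / yroot y) (at y)"
  unfolding yroot_def[abs_def]
  by (rule derivative_eq_intros refl yroot_radicand[OF assms] | simp)+

text \<open>Up to an additive constant this is \<open>Vfun (inverse (pfun y)) y\<close>. The logarithm is split in such
  a way that its arguments have positive real part, which makes holomorphy evident.\<close>
definition vhol :: "complex \<Rightarrow> complex" where
  "vhol y = Ln y - Ln (1 / 2 + yroot y) + 2 * yroot y"

lemma Re_vhol:
  assumes "Re y > 0"
  shows "Re (vhol y) = vfun y"
  using half_plus_yroot_nonzero[OF assms] pfun_nonzero[OF assms] assms
  by (cases "y = 0") (auto simp: vhol_def vfun_eq_norm_pfun[OF assms] ln_norm_pfun[OF assms])

text \<open>All terms other than \<open>2 * yroot y / y\<close> cancel because of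
  \<open>y\<^sup>2 = (yroot y - 1 / 2) * (yroot y + 1 / 2)\<close>.\<close>
lemma has_field_derivative_vhol:
  assumes "Re y > 0"
  shows "(vhol has_field_derivative 2 * yroot y / y) (at y)"
proof -
  let ?X = "yroot y"
  have X: "Re ?X > 0"
    using assms by (rule Re_yroot_pos)
  have nz: "y \<noteq> 0" "?X \<noteq> 0" "1 / 2 + ?X \<noteq> 0"
    using assms X half_plus_yroot_nonzero[OF assms] by auto
  have cut: "y \<notin> \<real>\<^sub>\<le>\<^sub>0" "1 / 2 + ?X \<notin> \<real>\<^sub>\<le>\<^sub>0"
    using assms X by (auto simp: complex_nonpos_Reals_iff)
  have "(vhol has_field_derivative 1 / y - (y / ?X) / (1 / 2 + ?X) + 2 * (y / ?X)) (at y)"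
    unfolding vhol_def[abs_def]
    by (rule derivative_eq_intros has_field_derivative_yroot[OF assms] refl cut
        | use cut in \<open>simp add: field_simps\<close>)+
  also have "1 / y - (y / ?X) / (1 / 2 + ?X) + 2 * (y / ?X) = 1 / y + 2 * y / (1 / 2 + ?X)"
    using nz by (simp add: divide_simps) (simp add: algebra_simps)
  also have "\<dots> = (1 / 2 + ?X + 2 * y\<^sup>2) / (y * (1 / 2 + ?X))"
    using nz by (simp add: divide_simps) (simp add: algebra_simps power2_eq_square)
  also have "1 / 2 + ?X + 2 * y\<^sup>2 = 2 * ?X * (1 / 2 + ?X)"
  proof -
    have "2 * y\<^sup>2 = 2 * ?X\<^sup>2 - 1 / 2"
      by (simp add: yroot_square)
    thus ?thesis
      by (simp add: algebra_simps power2_eq_square)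
  qed
  also have "2 * ?X * (1 / 2 + ?X) / (y * (1 / 2 + ?X)) = 2 * ?X / y"
    using nz by simp
  finally show ?thesis .
qed


section \<open>Perturbed level sets of a function that increases along rays\<close>

lemma norm_cis_diff_le: "cmod (cis s - cis t) \<le> \<bar>s - t\<bar>"
proof -
  have "cis s - cis t = cis t * (cis (s - t) - 1)"
    by (simp add: right_diff_distrib cis_mult)
  also have "cmod \<dots> = 2 * \<bar>sin ((s - t) / 2)\<bar>"
    using dist_exp_i_1[of "s - t"] by (simp add: norm_mult cis_conv_exp)
  also have "\<dots> \<le> \<bar>s - t\<bar>"
    using abs_sin_x_le_abs_x[of "(s - t) / 2"] by simp
  finally show ?thesis .
qed

lemma polar_dist_le:
  fixes r r' :: real
  assumes "0 \<le> r'" "r' \<le> b"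
  shows "cmod (of_real r * cis s - of_real r' * cis t) \<le> \<bar>r - r'\<bar> + b * \<bar>s - t\<bar>"
proof -
  have "of_real r * cis s - of_real r' * cis t
      = of_real (r - r') * cis s + of_real r' * (cis s - cis t)"
    by (simp add: algebra_simps)
  also have "cmod \<dots> \<le> \<bar>r - r'\<bar> + r' * cmod (cis s - cis t)"
    using norm_triangle_ineq[of "of_real (r - r') * cis s" "of_real r' * (cis s - cis t)"] assms
    by (simp add: norm_mult del: of_real_diff)
  also have "\<dots> \<le> \<bar>r - r'\<bar> + b * \<bar>s - t\<bar>"
    using assms norm_cis_diff_le[of s t] by (intro add_left_mono mult_mono) auto
  finally show ?thesis .
qed

text \<open>The setting abstracts from the particular function \<open>v\<close>: on a fan of rays, \<open>v\<close> grows at rate at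
  least \<open>c\<close> and passes from \<open>-d\<close> to \<open>d\<close> between the radii \<open>a\<close> and \<open>b\<close>, and it is Lipschitz on
  the polar rectangle \<open>{a..b} \<times> A\<close>. The Lipschitz bound is stated with the distance in the plane,
  because it comes from a bound on a complex derivative.\<close>
locale ray_increasing =
  fixes v :: "complex \<Rightarrow> real" and A :: "real set" and a b c d L :: real
  assumes angles: "A \<subseteq> {-pi<..pi}"
    and radii: "0 < a" "a \<le> b"
    and c_pos: "0 < c"
    and increase: "\<And>t r1 r2. t \<in> A \<Longrightarrow> 0 < r1 \<Longrightarrow> r1 \<le> r2 \<Longrightarrow>
        c * (r2 - r1) \<le> v (of_real r2 * cis t) - v (of_real r1 * cis t)"
    and inner: "\<And>t. t \<in> A \<Longrightarrow> v (of_real a * cis t) \<le> - d"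
    and outer: "\<And>t. t \<in> A \<Longrightarrow> d \<le> v (of_real b * cis t)"
    and lipschitz: "\<And>r r' s t. s \<in> A \<Longrightarrow> t \<in> A \<Longrightarrow> r \<in> {a..b} \<Longrightarrow> r' \<in> {a..b} \<Longrightarrow>
        \<bar>v (of_real r * cis s) - v (of_real r' * cis t)\<bar>
          \<le> L * cmod (of_real r * cis s - of_real r' * cis t)"
    and L_nonneg: "0 \<le> L"
begin

definition strip :: "complex set" where
  "strip = {y. \<exists>r t. 0 < r \<and> t \<in> A \<and> y = of_real r * cis t \<and> \<bar>v y\<bar> \<le> d}"

lemma strip_radius:
  assumes "0 < r" "t \<in> A" "\<bar>v (of_real r * cis t)\<bar> \<le> d"
  shows "r \<in> {a..b}"
proof (rule ccontr)
  assume "r \<notin> {a..b}"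
  then consider "r < a" | "b < r"
    by fastforce
  thus False
  proof cases
    case 1
    hence "0 < c * (a - r)"
      using c_pos by simp
    thus False
      using increase[OF assms(2,1), of a] inner[OF assms(2)] assms(3) 1 by linarith
  next
    case 2
    hence "0 < c * (r - b)"
      using c_pos by simp
    thus False
      using increase[OF assms(2), of b r] outer[OF assms(2)] assms(3) 2 radii by linarith
  qed
qed

lemma polar_inject:
  assumes "0 < r" "0 < r'" "s \<in> A" "t \<in> A" "of_real r * cis s = of_real r' * cis t"
  shows "r = r'" "s = t"
proof -
  have "Arg (cis s) = s" "Arg (cis t) = t"
    using assms(3,4) angles by (auto intro!: Arg_cis)
  hence *: "Arg (of_real r * cis s) = s" "Arg (of_real r' * cis t) = t"
    using assms(1,2) by simp_all
  have "cmod (of_real r * cis s) = cmod (of_real r' * cis t)"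
    using assms(5) by simp
  thus "r = r'"
    using assms(1,2) by (simp add: norm_mult)
  show "s = t"
    using * assms(5) by metis
qed

end

text \<open>The curve under study is \<open>v = l + e * h\<close>. The condition \<open>e * L \<le> c / 2\<close> keeps the perturbation
  from cancelling more than half of the radial growth of \<open>v\<close>, and the condition on the level
  keeps the curve inside the strip \<open>\<bar>v\<bar> \<le> d\<close>.\<close>
locale perturbed_level = ray_increasing +
  fixes h :: "complex \<Rightarrow> real" and M l e :: real
  assumes h_lipschitz: "\<And>r r' s t. s \<in> A \<Longrightarrow> t \<in> A \<Longrightarrow> r \<in> {a..b} \<Longrightarrow> r' \<in> {a..b} \<Longrightarrow>
        \<bar>h (of_real r * cis s) - h (of_real r' * cis t)\<bar>
          \<le> L * cmod (of_real r * cis s - of_real r' * cis t)"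
    and h_bound: "\<And>r t. t \<in> A \<Longrightarrow> r \<in> {a..b} \<Longrightarrow> \<bar>h (of_real r * cis t)\<bar> \<le> M"
    and e_nonneg: "0 \<le> e"
    and level_bound: "\<bar>l\<bar> + e * M \<le> d"
    and e_small: "e * L \<le> c / 2"
begin

definition gap :: "complex \<Rightarrow> real" where
  "gap y = v y - (l + e * h y)"

lemma perturbation_bound:
  assumes "t \<in> A" "r \<in> {a..b}"
  shows "\<bar>e * h (of_real r * cis t)\<bar> \<le> e * M"
  using h_bound[OF assms] e_nonneg by (simp add: abs_mult mult_left_mono)

lemma gap_increase:
  assumes "t \<in> A" "a \<le> r1" "r1 \<le> r2" "r2 \<le> b"
  shows "c / 2 * (r2 - r1) \<le> gap (of_real r2 * cis t) - gap (of_real r1 * cis t)"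
proof -
  have "\<bar>e * (h (of_real r2 * cis t) - h (of_real r1 * cis t))\<bar>
      \<le> e * (L * cmod (of_real r2 * cis t - of_real r1 * cis t))"
    using h_lipschitz[of t t r2 r1] assms e_nonneg by (simp add: abs_mult mult_left_mono)
  also have "of_real r2 * cis t - of_real r1 * cis t = of_real (r2 - r1) * cis t"
    by (simp add: algebra_simps)
  also have "e * (L * cmod \<dots>) = e * L * (r2 - r1)"
    using assms by (simp add: norm_mult del: of_real_diff)
  also have "\<dots> \<le> c / 2 * (r2 - r1)"
    using e_small assms by (intro mult_right_mono) auto
  finally have "e * (h (of_real r2 * cis t) - h (of_real r1 * cis t)) \<le> c / 2 * (r2 - r1)"
    by (rule order_trans[OF abs_ge_self])
  moreover have "c * (r2 - r1) \<le> v (of_real r2 * cis t) - v (of_real r1 * cis t)"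
    using assms radii by (intro increase) auto
  ultimately show ?thesis
    unfolding gap_def right_diff_distrib[of e] by (simp add: field_simps)
qed

lemma gap_strict_mono:
  assumes "t \<in> A" "a \<le> r1" "r1 < r2" "r2 \<le> b"
  shows "gap (of_real r1 * cis t) < gap (of_real r2 * cis t)"
proof -
  have "0 < c / 2 * (r2 - r1)"
    using assms c_pos by simp
  thus ?thesis
    using gap_increase[of t r1 r2] assms by simp
qed

lemma ex_crossing:
  assumes "t \<in> A"
  shows "\<exists>r\<in>{a..b}. gap (of_real r * cis t) = 0"
proof -
  have *: "(L + e * L)-lipschitz_on {a..b} (\<lambda>r. gap (of_real r * cis t))"
  proof (rule lipschitz_onI)
    fix x y
    assume xy: "x \<in> {a..b}" "y \<in> {a..b}"
    have "of_real x * cis t - of_real y * cis t = of_real (x - y) * cis t"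
      by (simp add: algebra_simps)
    hence n: "cmod (of_real x * cis t - of_real y * cis t) = \<bar>x - y\<bar>"
      by (simp add: norm_mult del: of_real_diff)
    have "e * \<bar>h (of_real x * cis t) - h (of_real y * cis t)\<bar> \<le> e * (L * \<bar>x - y\<bar>)"
      using h_lipschitz[OF assms assms xy] n e_nonneg by (intro mult_left_mono) auto
    hence "\<bar>e * h (of_real x * cis t) - e * h (of_real y * cis t)\<bar> \<le> e * L * \<bar>x - y\<bar>"
      using e_nonneg by (simp add: abs_mult flip: right_diff_distrib)
    thus "dist (gap (of_real x * cis t)) (gap (of_real y * cis t)) \<le> (L + e * L) * dist x y"
      using lipschitz[OF assms assms xy] n by (simp add: gap_def dist_real_def algebra_simps)
  qed (use L_nonneg e_nonneg in simp)
  have "gap (of_real a * cis t) \<le> 0" "0 \<le> gap (of_real b * cis t)"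
    using inner[OF assms] outer[OF assms] level_bound radii
      perturbation_bound[OF assms, of a] perturbation_bound[OF assms, of b]
    by (simp_all add: gap_def)
  from IVT'[OF this radii(2) lipschitz_on_continuous_on[OF *]] show ?thesis
    by auto
qed

definition radius :: "real \<Rightarrow> real" where
  "radius t = (SOME r. r \<in> {a..b} \<and> gap (of_real r * cis t) = 0)"

lemma radius_props:
  assumes "t \<in> A"
  shows "radius t \<in> {a..b}" "gap (of_real (radius t) * cis t) = 0"
  using someI_ex[of "\<lambda>r. r \<in> {a..b} \<and> gap (of_real r * cis t) = 0"] ex_crossing[OF assms]
  unfolding radius_def by blast+

lemma v_radius:
  assumes "t \<in> A"
  shows "v (of_real (radius t) * cis t) = l + e * h (of_real (radius t) * cis t)"
  using radius_props(2)[OF assms] by (simp add: gap_def)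

lemma less_radius_iff:
  assumes "t \<in> A" "r \<in> {a..b}"
  shows "r < radius t \<longleftrightarrow> gap (of_real r * cis t) < 0"
  using gap_strict_mono[OF assms(1), of r "radius t"] gap_strict_mono[OF assms(1), of "radius t" r]
    radius_props[OF assms(1)] assms(2)
  by (cases r "radius t" rule: linorder_cases) auto

lemma radius_unique:
  assumes "t \<in> A" "r \<in> {a..b}" "gap (of_real r * cis t) = 0"
  shows "r = radius t"
  using gap_strict_mono[OF assms(1), of r "radius t"] gap_strict_mono[OF assms(1), of "radius t" r]
    radius_props[OF assms(1)] assms(2,3)
  by (cases r "radius t" rule: linorder_cases) auto

lemma abs_v_radius_le:
  assumes "t \<in> A"
  shows "\<bar>v (of_real (radius t) * cis t)\<bar> \<le> \<bar>l\<bar> + e * M"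
  using v_radius[OF assms] perturbation_bound[OF assms radius_props(1)[OF assms]] by linarith

text \<open>The defect \<open>gap\<close> is strictly increasing along each ray and changes sign between the radii \<open>a\<close>
  and \<open>b\<close>, so that the perturbed level set is the graph of \<open>radius\<close> in polar coordinates.\<close>
lemma level_curve_eq:
  "{y \<in> strip. v y = l + e * h y} = (\<lambda>t. of_real (radius t) * cis t) ` A"
proof (intro equalityI subsetI)
  fix y
  assume "y \<in> {y \<in> strip. v y = l + e * h y}"
  then obtain r t where rt: "0 < r" "t \<in> A" "y = of_real r * cis t" "\<bar>v y\<bar> \<le> d" "gap y = 0"
    by (auto simp: strip_def gap_def)
  have "r = radius t"
    using rt strip_radius[of r t] by (intro radius_unique) auto
  thus "y \<in> (\<lambda>t. of_real (radius t) * cis t) ` A"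
    using rt by auto
next
  fix y
  assume "y \<in> (\<lambda>t. of_real (radius t) * cis t) ` A"
  then obtain t where t: "t \<in> A" "y = of_real (radius t) * cis t"
    by auto
  have "\<bar>v y\<bar> \<le> d" "v y = l + e * h y" "0 < radius t"
    using abs_v_radius_le[OF t(1)] v_radius[OF t(1)] level_bound radius_props(1)[OF t(1)] radii t
    by auto
  thus "y \<in> {y \<in> strip. v y = l + e * h y}"
    using t by (auto simp: strip_def)
qed

text \<open>Along the curve, \<open>v\<close> varies only through \<open>e * h\<close>, so its variation is at most \<open>e * L\<close> times the
  length travelled. That length is in turn controlled by the angle: moving back along the ray
  costs at least \<open>c\<close> per unit of radius, and moving along a circle changes \<open>v\<close> by at most \<open>L\<close> per
  unit of length. As \<open>e * L \<le> c / 2\<close>, the resulting estimate for the radius can be solved.\<close>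
lemma radius_lipschitz:
  assumes "s \<in> A" "t \<in> A"
  shows "\<bar>radius s - radius t\<bar> \<le> (b + 2 * L * b / c) * \<bar>s - t\<bar>"
    and "\<bar>v (of_real (radius s) * cis s) - v (of_real (radius t) * cis t)\<bar>
      \<le> e * L * ((2 * b + 2 * L * b / c) * \<bar>s - t\<bar>)"
proof -
  define ys yt yst where
    "ys = of_real (radius s) * cis s" and "yt = of_real (radius t) * cis t"
    and "yst = of_real (radius t) * cis s"
  note rs = radius_props(1)[OF assms(1)] and rt = radius_props(1)[OF assms(2)]
  have dist: "cmod (ys - yt) \<le> \<bar>radius s - radius t\<bar> + b * \<bar>s - t\<bar>"
    "cmod (yst - yt) \<le> b * \<bar>s - t\<bar>"
    using polar_dist_le[of "radius t" b "radius s" s t] polar_dist_le[of "radius t" b "radius t" s t]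
      rt radii by (auto simp: ys_def yt_def yst_def)
  have 1: "\<bar>v ys - v yt\<bar> \<le> e * L * cmod (ys - yt)"
  proof -
    have "\<bar>v ys - v yt\<bar> = e * \<bar>h ys - h yt\<bar>"
      using v_radius[OF assms(1)] v_radius[OF assms(2)] e_nonneg
      by (simp add: ys_def yt_def abs_mult flip: right_diff_distrib)
    also have "\<dots> \<le> e * (L * cmod (ys - yt))"
      unfolding ys_def yt_def using e_nonneg h_lipschitz[OF assms rs rt]
      by (intro mult_left_mono)
    finally show ?thesis
      by (simp add: mult.assoc)
  qed
  have 2: "c * \<bar>radius s - radius t\<bar> \<le> \<bar>v ys - v yst\<bar>"
    using increase[OF assms(1), of "radius s" "radius t"]
      increase[OF assms(1), of "radius t" "radius s"] rs rt radii c_pos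
    by (cases "radius s" "radius t" rule: linorder_le_cases)
      (auto simp: ys_def yst_def algebra_simps abs_if)
  have 3: "\<bar>v yst - v yt\<bar> \<le> L * (b * \<bar>s - t\<bar>)"
  proof -
    have "\<bar>v yst - v yt\<bar> \<le> L * cmod (yst - yt)"
      unfolding yst_def yt_def by (rule lipschitz[OF assms rt rt])
    also have "\<dots> \<le> L * (b * \<bar>s - t\<bar>)"
      using dist L_nonneg by (intro mult_left_mono)
    finally show ?thesis .
  qed
  have "e * L * cmod (ys - yt) \<le> c / 2 * (\<bar>radius s - radius t\<bar> + b * \<bar>s - t\<bar>)"
    using e_small dist e_nonneg L_nonneg c_pos by (intro mult_mono) auto
  with 1 2 3 have *: "c * \<bar>radius s - radius t\<bar>
      \<le> c / 2 * (\<bar>radius s - radius t\<bar> + b * \<bar>s - t\<bar>) + L * (b * \<bar>s - t\<bar>)"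
    by linarith
  have "c / 2 * \<bar>radius s - radius t\<bar> \<le> c / 2 * ((b + 2 * L * b / c) * \<bar>s - t\<bar>)"
  proof -
    have "c / 2 * ((b + 2 * L * b / c) * \<bar>s - t\<bar>) = c / 2 * (b * \<bar>s - t\<bar>) + L * (b * \<bar>s - t\<bar>)"
      using c_pos by (simp add: field_simps)
    thus ?thesis
      using * by (simp add: distrib_left)
  qed
  thus 4: "\<bar>radius s - radius t\<bar> \<le> (b + 2 * L * b / c) * \<bar>s - t\<bar>"
    using c_pos by simp
  have "e * L * cmod (ys - yt) \<le> e * L * ((2 * b + 2 * L * b / c) * \<bar>s - t\<bar>)"
    using dist(1) 4 e_nonneg L_nonneg by (intro mult_left_mono) (auto simp: algebra_simps)
  with 1 show "\<bar>v (of_real (radius s) * cis s) - v (of_real (radius t) * cis t)\<bar>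
      \<le> e * L * ((2 * b + 2 * L * b / c) * \<bar>s - t\<bar>)"
    by (simp add: ys_def yt_def)
qed

lemma continuous_on_radius: "continuous_on A radius"
  by (rule lipschitz_on_continuous_on[of "b + 2 * L * b / c"], rule lipschitz_onI)
    (use radius_lipschitz(1) radii c_pos L_nonneg in \<open>auto simp: dist_real_def\<close>)

end

context ray_increasing
begin

text \<open>For two perturbed levels with pointwise ordered right-hand sides, the defect of the higher one
  is negative on the lower curve, which therefore lies closer to the origin on each ray. The
  distance to \<open>E\<close> is measured along rays: the ray through a point of the curve meets the zero
  level of \<open>v\<close>, and the radial growth of \<open>v\<close> bounds how far away that happens.\<close>
lemma perturbed_levels_ordered_parallel:
  fixes l :: "nat \<Rightarrow> real" and h :: "nat \<Rightarrow> complex \<Rightarrow> real"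
  assumes level: "\<And>i. i < m \<Longrightarrow> perturbed_level v A a b c d L (h i) M (l i) e"
    and separated: "\<And>i j r t. i < j \<Longrightarrow> j < m \<Longrightarrow> t \<in> A \<Longrightarrow> r \<in> {a..b} \<Longrightarrow>
        l i + e * h i (of_real r * cis t) < l j + e * h j (of_real r * cis t)"
    and E: "\<And>r t. 0 < r \<Longrightarrow> t \<in> A \<Longrightarrow> v (of_real r * cis t) = 0 \<Longrightarrow> of_real r * cis t \<in> E"
    and d_nonneg: "0 \<le> d"
    and eta: "\<And>i. i < m \<Longrightarrow> \<bar>l i\<bar> + e * M \<le> c * eta"
    and eps: "e * L * (2 * b + 2 * L * b / c) \<le> eps"
    and cs: "cs = map (\<lambda>i. {y \<in> strip. v y = l i + e * h i y}) [0..<m]"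
  shows "ordered_parallel_arcs v E cis A eta eps cs"
proof -
  define \<rho> where "\<rho> = (\<lambda>i. perturbed_level.radius v a b (h i) (l i) e)"
  define Y where "Y = (\<lambda>i t. of_real (\<rho> i t) * cis t)"
  have \<rho>: "\<rho> i t \<in> {a..b}" if "i < m" "t \<in> A" for i t
    using perturbed_level.radius_props(1)[OF level[OF that(1)] that(2)] by (simp add: \<rho>_def)
  have curve: "cs ! i = Y i ` A" if "i < m" for i
    using that perturbed_level.level_curve_eq[OF level[OF that]] by (simp add: cs \<rho>_def Y_def)
  have less: "\<rho> i t < \<rho> j t" if "i < j" "j < m" "t \<in> A" for i j t
  proof -
    have i: "i < m"
      using that by simp
    have "v (Y i t) = l i + e * h i (Y i t)"
      using perturbed_level.v_radius[OF level[OF i] that(3)] by (simp add: \<rho>_def Y_def)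
    also have "\<dots> < l j + e * h j (Y i t)"
      unfolding Y_def using that \<rho>[OF i that(3)] by (intro separated) auto
    finally show ?thesis
      using perturbed_level.less_radius_iff[OF level[OF that(2)] that(3) \<rho>[OF i that(3)]]
      by (simp add: perturbed_level.gap_def[OF level[OF that(2)]] \<rho>_def Y_def)
  qed
  have v_less: "v (Y i t) < v (Y j t)" if "i < j" "j < m" "t \<in> A" for i j t
  proof -
    have "0 < \<rho> i t"
      using that \<rho>[of i t] radii by auto
    moreover have "0 < c * (\<rho> j t - \<rho> i t)"
      using less[OF that] c_pos by simp
    ultimately show ?thesis
      unfolding Y_def using increase[OF that(3), of "\<rho> i t" "\<rho> j t"] less[OF that] by linarith
  qed
  have disjoint: "cs ! i \<inter> cs ! j = {}" if "i < j" "j < m" for i j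
  proof (rule ccontr)
    assume "cs ! i \<inter> cs ! j \<noteq> {}"
    moreover have "cs ! i = Y i ` A" "cs ! j = Y j ` A"
      using that by (auto intro!: curve)
    ultimately obtain s t where st: "s \<in> A" "t \<in> A" "Y i s = Y j t"
      by fastforce
    have "0 < \<rho> i s" "0 < \<rho> j t"
      using that st \<rho>[of i s] \<rho>[of j t] radii by auto
    with st have "\<rho> i s = \<rho> j t" "s = t"
      using polar_inject[of "\<rho> i s" "\<rho> j t" s t] by (auto simp: Y_def)
    with less[OF that st(2)] show False
      by simp
  qed
  have lip: "\<bar>v (Y i s) - v (Y i t)\<bar> \<le> eps * \<bar>s - t\<bar>" if "i < m" "s \<in> A" "t \<in> A" for i s t
  proof -
    have "\<bar>v (Y i s) - v (Y i t)\<bar> \<le> e * L * (2 * b + 2 * L * b / c) * \<bar>s - t\<bar>"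
      using perturbed_level.radius_lipschitz(2)[OF level[OF that(1)] that(2,3)]
      by (simp add: \<rho>_def Y_def mult.assoc)
    also have "\<dots> \<le> eps * \<bar>s - t\<bar>"
      using eps by (intro mult_right_mono) auto
    finally show ?thesis .
  qed
  \<comment> \<open>The unperturbed level set of height 0 represents E on each ray.\<close>
  interpret zero: perturbed_level v A a b c d L "\<lambda>_. 0" 0 0 0
    by unfold_locales (use d_nonneg L_nonneg c_pos in auto)
  have near: "infdist (Y i t) E \<le> eta" if "i < m" "t \<in> A" for i t
  proof -
    define r where "r = zero.radius t"
    have r: "r \<in> {a..b}" "v (of_real r * cis t) = 0"
      using zero.radius_props(1)[OF that(2)] zero.v_radius[OF that(2)] by (simp_all add: r_def)
    have rho: "0 < \<rho> i t" "0 < r"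
      using \<rho>[OF that] r radii by auto
    have "c * \<bar>\<rho> i t - r\<bar> \<le> \<bar>v (Y i t) - v (of_real r * cis t)\<bar>"
      using increase[OF that(2), of "\<rho> i t" r] increase[OF that(2), of r "\<rho> i t"] rho c_pos
      by (cases "\<rho> i t" r rule: linorder_le_cases) (auto simp: Y_def algebra_simps abs_if)
    also have "\<dots> \<le> c * eta"
      using perturbed_level.abs_v_radius_le[OF level[OF that(1)] that(2)] eta[OF that(1)] r(2)
      by (simp add: \<rho>_def Y_def)
    finally have "\<bar>\<rho> i t - r\<bar> \<le> eta"
      using c_pos by simp
    moreover have "dist (Y i t) (of_real r * cis t) \<le> \<bar>\<rho> i t - r\<bar>"
      using polar_dist_le[of r b "\<rho> i t" t t] rho r by (simp add: Y_def dist_norm)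
    ultimately show ?thesis
      using E[OF rho(2) that(2) r(2)] by (intro infdist_le2[of "of_real r * cis t"]) auto
  qed
  have len: "length cs = m"
    by (simp add: cs)
  have cont: "continuous_on A (\<rho> i)" if "i < m" for i
    using perturbed_level.continuous_on_radius[OF level[OF that]] by (simp add: \<rho>_def)
  have pos: "0 < \<rho> i t" if "i < m" "t \<in> A" for i t
    using \<rho>[OF that] radii by auto
  have near': "infdist y E \<le> eta" if "i < m" "y \<in> cs ! i" for i y
    using that curve[OF that(1)] near[OF that(1)] by auto
  show ?thesis
    unfolding ordered_parallel_arcs_def len
    using disjoint near' less v_less lip cont pos curve unfolding Y_def
    by (intro conjI exI[of _ \<rho>] allI impI ballI) simp_all
qed

end

lemma ordered_parallel_arcs_uminus:
  assumes "ordered_parallel_arcs w E d A eta eps cs"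
  shows "ordered_parallel_arcs (\<lambda>y. w (- y)) (uminus ` E) (\<lambda>t. - d t) A eta eps
    (map ((`) uminus) cs)"
proof -
  from assms obtain r where
    disj: "\<forall>i j. i < j \<and> j < length cs \<longrightarrow> cs ! i \<inter> cs ! j = {}" and
    curve: "\<forall>i<length cs. continuous_on A (r i) \<and> (\<forall>t\<in>A. r i t > 0)
      \<and> cs ! i = (\<lambda>t. of_real (r i t) * d t) ` A" and
    less: "\<forall>i j. i < j \<and> j < length cs \<longrightarrow>
      (\<forall>t\<in>A. r i t < r j t \<and> w (of_real (r i t) * d t) < w (of_real (r j t) * d t))" and
    lip: "\<forall>i<length cs. \<forall>s\<in>A. \<forall>t\<in>A.
      \<bar>w (of_real (r i s) * d s) - w (of_real (r i t) * d t)\<bar> \<le> eps * \<bar>s - t\<bar>" and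
    near: "\<forall>i<length cs. \<forall>y\<in>cs ! i. infdist y E \<le> eta"
    unfolding ordered_parallel_arcs_def by (elim conjE exE) (rule that)
  have inf: "infdist (- y) (uminus ` E) = infdist y E" for y
    by (simp add: infdist_def dist_minus image_image)
  have disj': "uminus ` (cs ! i) \<inter> uminus ` (cs ! j) = {}" if "i < j" "j < length cs" for i j
    using disj that by (metis image_Int image_empty inj_uminus)
  have curve': "uminus ` (cs ! i) = (\<lambda>t. of_real (r i t) * - d t) ` A" if "i < length cs" for i
    using curve that by (simp add: image_image)
  have near': "infdist y (uminus ` E) \<le> eta" if "i < length cs" "y \<in> uminus ` (cs ! i)" for i y
    using near that by (auto simp: inf)
  show ?thesis
    unfolding ordered_parallel_arcs_def length_map
    using disj' curve curve' less lip near'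
    by (intro conjI exI[of _ r] allI impI ballI; (elim conjE)?) simp_all
qed


section \<open>The function v on sectors\<close>

lemma Re_polar_pos:
  assumes "0 < r" "\<bar>t\<bar> < pi / 2"
  shows "0 < Re (of_real r * cis t)"
  using assms cos_gt_zero_pi[of t] by (simp add: abs_less_iff)

text \<open>The radial derivative of \<open>v\<close> at \<open>y\<close> with \<open>\<bar>y\<bar> = r\<close> is \<open>2 / r * Re (yroot y)\<close>, which is at least
  \<open>2 / r * Re y = 2 * cos t\<close>.\<close>
lemma vfun_increase:
  assumes "\<bar>t\<bar> < pi / 2" "0 < r1" "r1 \<le> r2"
  shows "2 * cos t * (r2 - r1) \<le> vfun (of_real r2 * cis t) - vfun (of_real r1 * cis t)"
proof -
  let ?f = "\<lambda>r. Re (vhol (of_real r * cis t)) - 2 * cos t * r"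
  have "?f r1 \<le> ?f r2"
  proof (rule DERIV_nonneg_imp_nondecreasing[OF assms(3)])
    fix r :: real
    assume r: "r1 \<le> r" "r \<le> r2"
    define y where "y = of_real r * cis t"
    have r0: "0 < r"
      using r assms by simp
    have y: "0 < Re y"
      unfolding y_def using r0 assms(1) by (rule Re_polar_pos)
    have "((\<lambda>r. of_real r * cis t) has_vector_derivative cis t) (at r)"
      by (auto intro!: derivative_eq_intros)
    moreover have "(vhol has_field_derivative 2 * yroot y / y) (at (of_real r * cis t))"
      using has_field_derivative_vhol[OF y] by (simp add: y_def)
    ultimately have "((\<lambda>r. vhol (of_real r * cis t)) has_vector_derivative
        cis t * (2 * yroot y / y)) (at r)"
      by (rule field_vector_diff_chain_at[unfolded o_def])
    from bounded_linear.has_vector_derivative[OF bounded_linear_Re this]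
    have deriv: "((\<lambda>r. Re (vhol (of_real r * cis t))) has_real_derivative
        Re (cis t * (2 * yroot y / y))) (at r)"
      by (simp add: has_real_derivative_iff_has_vector_derivative)
    have "cis t * (2 * yroot y / y) = of_real (2 / r) * yroot y"
      using r0 by (simp add: y_def field_simps)
    hence "Re (cis t * (2 * yroot y / y)) = 2 / r * Re (yroot y)"
      by simp
    also have "\<dots> \<ge> 2 / r * Re y"
      using Re_yroot_ge[OF y] r0 by (intro mult_left_mono) auto
    also have "2 / r * Re y = 2 * cos t"
      using r0 by (simp add: y_def)
    finally have "0 \<le> Re (cis t * (2 * yroot y / y)) - 2 * cos t"
      by simp
    moreover have "(?f has_real_derivative Re (cis t * (2 * yroot y / y)) - 2 * cos t) (at r)"
      by (rule derivative_eq_intros deriv refl | simp)+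
    ultimately show "\<exists>D. (?f has_real_derivative D) (at r) \<and> 0 \<le> D"
      by blast
  qed
  moreover have "Re (vhol (of_real r * cis t)) = vfun (of_real r * cis t)" if "0 < r" for r
    using Re_polar_pos[OF that assms(1)] by (rule Re_vhol)
  ultimately show ?thesis
    using assms by (simp add: algebra_simps)
qed

text \<open>As \<open>\<bar>p\<bar> \<le> 2 * \<bar>y\<bar>\<close>, the term \<open>ln \<bar>p\<bar>\<close> of \<open>v\<close> tends to minus infinity at the origin, while
  the other term is at most 2 for \<open>\<bar>y\<bar> \<le> 1 / 2\<close>.\<close>
lemma vfun_near_0:
  assumes "0 < Re y" "cmod y \<le> exp (- d - 2) / 2" "0 \<le> d"
  shows "vfun y \<le> - d"
proof -
  have y: "y \<noteq> 0"
    using assms(1) by auto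
  have "exp (- d - 2) \<le> (1 :: real)"
    using assms(3) by simp
  hence "cmod y \<le> 1 / 2"
    using assms(2) by linarith
  hence "(cmod y)\<^sup>2 \<le> (1 / 2)\<^sup>2"
    by (intro power_mono) auto
  hence "cmod ((yroot y)\<^sup>2) \<le> 1"
    using norm_triangle_ineq[of "y\<^sup>2" "1 / 4"]
    by (simp add: yroot_square norm_power power_divide norm_divide)
  hence "cmod (yroot y) \<le> 1"
    by (simp add: norm_power power_le_one_iff)
  hence "Re (yroot y) \<le> 1"
    using complex_Re_le_cmod[of "yroot y"] by linarith
  moreover have "ln (cmod (pfun y)) \<le> ln (exp (- d - 2))"
    using norm_pfun_le[OF assms(1)] pfun_nonzero[OF assms(1)] assms(2)
    by (subst ln_le_cancel_iff) auto
  ultimately show ?thesis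
    by (simp add: vfun_eq_norm_pfun[OF assms(1)])
qed

text \<open>A polar rectangle need not be convex. It is contained in such a segment of a disc, which is
  convex and compact and, for positive \<open>\<alpha>\<close>, still contained in the right half-plane; there a
  bound on a derivative yields a Lipschitz constant.\<close>
definition half_disc :: "real \<Rightarrow> real \<Rightarrow> complex set" where
  "half_disc \<alpha> b = {y. \<alpha> \<le> Re y} \<inter> cball 0 b"

lemma Re_holomorphic_half_disc:
  assumes "f holomorphic_on {y. 0 < Re y}" "0 < \<alpha>"
  obtains L where "0 \<le> L"
    "\<And>y. y \<in> half_disc \<alpha> b \<Longrightarrow> \<bar>Re (f y)\<bar> \<le> L"
    "\<And>y y'. y \<in> half_disc \<alpha> b \<Longrightarrow> y' \<in> half_disc \<alpha> b \<Longrightarrow>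
      \<bar>Re (f y) - Re (f y')\<bar> \<le> L * cmod (y - y')"
proof -
  let ?K = "half_disc \<alpha> b"
  have K: "compact ?K" "convex ?K"
    unfolding half_disc_def
    by (intro closed_Int_compact convex_Int closed_halfspace_Re_ge convex_halfspace_Re_ge; simp)+
  have sub: "?K \<subseteq> {y. 0 < Re y}"
    using assms(2) by (auto simp: half_disc_def)
  have opn: "open {y. 0 < Re y}"
    by (rule open_halfspace_Re_gt)
  have "bounded (f ` ?K)" "bounded (deriv f ` ?K)"
    using assms(1) sub K(1) holomorphic_deriv[OF assms(1) opn]
    by (auto intro!: compact_imp_bounded compact_continuous_image holomorphic_on_imp_continuous_on
        dest: holomorphic_on_subset)
  then obtain B1 B2 where B: "\<forall>y\<in>?K. cmod (f y) \<le> B1" "\<forall>y\<in>?K. cmod (deriv f y) \<le> B2"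
    by (auto simp: bounded_iff)
  define L where "L = max 0 (max B1 B2)"
  show thesis
  proof (rule that[of L])
    show "0 \<le> L"
      by (simp add: L_def)
    show "\<bar>Re (f y)\<bar> \<le> L" if "y \<in> ?K" for y
      using bspec[OF B(1) that] abs_Re_le_cmod[of "f y"] by (simp add: L_def)
    show "\<bar>Re (f y) - Re (f y')\<bar> \<le> L * cmod (y - y')" if y: "y \<in> ?K" "y' \<in> ?K" for y y'
    proof -
      have "cmod (f y - f y') \<le> L * cmod (y - y')"
      proof (rule field_differentiable_bound[OF K(2)])
        show "(f has_field_derivative deriv f z) (at z within ?K)" if "z \<in> ?K" for z
          using holomorphic_derivI[OF assms(1) opn] sub that by blast
        show "cmod (deriv f z) \<le> L" if "z \<in> ?K" for z
          using bspec[OF B(2) that] by (simp add: L_def)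
      qed (use y in auto)
      thus ?thesis
        using abs_Re_le_cmod[of "f y - f y'"] by simp
    qed
  qed
qed

lemma vhol_holomorphic: "vhol holomorphic_on {y. 0 < Re y}"
  using has_field_derivative_vhol
  by (auto simp: holomorphic_on_open[OF open_halfspace_Re_gt])

lemma yroot_holomorphic: "yroot holomorphic_on {y. 0 < Re y}"
  using has_field_derivative_yroot
  by (auto simp: holomorphic_on_open[OF open_halfspace_Re_gt])

lemma polar_in_half_disc:
  assumes "0 \<le> \<beta>" "\<beta> \<le> pi" "\<bar>t\<bar> \<le> \<beta>" "0 < a" "a \<le> r" "r \<le> b" "\<alpha> \<le> a * cos \<beta>" "0 \<le> cos \<beta>"
  shows "of_real r * cis t \<in> half_disc \<alpha> b"
proof -
  have "cos \<beta> \<le> cos \<bar>t\<bar>"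
    using assms by (intro cos_monotone_0_pi_le) auto
  hence "a * cos \<beta> \<le> r * cos t"
    using assms by (intro mult_mono) (auto simp: abs_if split: if_splits)
  thus ?thesis
    using assms by (auto simp: half_disc_def norm_mult)
qed

text \<open>The Lipschitz constant may be replaced by any larger one, so that it can be made to serve the
  perturbations of \<open>v\<close> as well.\<close>
lemma vfun_ray_increasing:
  assumes "0 \<le> \<beta>" "\<beta> < pi / 2" "0 \<le> d"
  obtains a b \<alpha> L where "0 < \<alpha>" "\<alpha> = a * cos \<beta>"
    "\<And>L'. L \<le> L' \<Longrightarrow> ray_increasing vfun {- \<beta>..\<beta>} a b (2 * cos \<beta>) d L'"
proof -
  define c where "c = 2 * cos \<beta>"
  have cos: "0 < cos \<beta>"
    using assms by (intro cos_gt_zero_pi) auto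
  hence c: "0 < c"
    by (simp add: c_def)
  have Re_pos: "0 < Re (of_real r * cis t)" if "0 < r" "t \<in> {- \<beta>..\<beta>}" for r t
    using that assms by (intro Re_polar_pos) auto
  have increase: "c * (r2 - r1) \<le> vfun (of_real r2 * cis t) - vfun (of_real r1 * cis t)"
    if "t \<in> {- \<beta>..\<beta>}" "0 < r1" "r1 \<le> r2" for t r1 r2
  proof -
    have "cos \<beta> \<le> cos \<bar>t\<bar>"
      using that assms by (intro cos_monotone_0_pi_le) auto
    hence "c \<le> 2 * cos t"
      by (simp add: c_def abs_if split: if_splits)
    hence "c * (r2 - r1) \<le> 2 * cos t * (r2 - r1)"
      using that by (intro mult_right_mono) auto
    also have "\<dots> \<le> vfun (of_real r2 * cis t) - vfun (of_real r1 * cis t)"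
      using that assms by (intro vfun_increase) auto
    finally show ?thesis .
  qed
  obtain B where B: "0 \<le> B" "\<And>y. y \<in> half_disc (cos \<beta>) 1 \<Longrightarrow> \<bar>Re (vhol y)\<bar> \<le> B"
    using Re_holomorphic_half_disc[OF vhol_holomorphic cos] by metis
  define a where "a = exp (- d - 2) / 2"
  \<comment> \<open>At radius 1 the value of v is at least -B, and from there v grows at least at rate c.\<close>
  define b where "b = 1 + (B + d) / c"
  have a: "0 < a" "a \<le> 1"
    using assms(3) by (auto simp: a_def intro: order_trans[of _ 1])
  have b: "1 \<le> b"
    using B c assms(3) by (simp add: b_def)
  have \<alpha>: "0 < a * cos \<beta>"
    using a cos by simp
  obtain L where L: "0 \<le> L" "\<And>y y'. y \<in> half_disc (a * cos \<beta>) b \<Longrightarrow>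
      y' \<in> half_disc (a * cos \<beta>) b \<Longrightarrow> \<bar>Re (vhol y) - Re (vhol y')\<bar> \<le> L * cmod (y - y')"
    using Re_holomorphic_half_disc[OF vhol_holomorphic \<alpha>] by metis
  have outer: "d \<le> vfun (of_real b * cis t)" if "t \<in> {- \<beta>..\<beta>}" for t
  proof -
    have "of_real 1 * cis t \<in> half_disc (cos \<beta>) 1"
      using that assms cos by (intro polar_in_half_disc[of \<beta> _ 1]) auto
    hence "\<bar>vfun (of_real 1 * cis t)\<bar> \<le> B"
      using B(2) Re_vhol[OF Re_pos[OF zero_less_one that]] by fastforce
    moreover have "c * (b - 1) = B + d"
      using c by (simp add: b_def)
    ultimately show ?thesis
      using increase[OF that, of 1 b] b by linarith
  qed
  show thesis
  proof (rule that[of "a * cos \<beta>" a L b])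
    fix L'
    assume L': "L \<le> L'"
    have "ray_increasing vfun {- \<beta>..\<beta>} a b c d L'"
    proof
      show "{- \<beta>..\<beta>} \<subseteq> {- pi<..pi}"
        using assms by auto
      show "vfun (of_real a * cis t) \<le> - d" if "t \<in> {- \<beta>..\<beta>}" for t
        using that a assms(3) Re_pos
        by (intro vfun_near_0) (auto simp: norm_mult a_def)
      fix r r' s t
      assume *: "s \<in> {- \<beta>..\<beta>}" "t \<in> {- \<beta>..\<beta>}" "r \<in> {a..b}" "r' \<in> {a..b}"
      have "of_real r * cis s \<in> half_disc (a * cos \<beta>) b"
        "of_real r' * cis t \<in> half_disc (a * cos \<beta>) b"
        using * a assms cos by (auto intro!: polar_in_half_disc[of \<beta> _ a])
      moreover have "Re (vhol (of_real r * cis s)) = vfun (of_real r * cis s)"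
        "Re (vhol (of_real r' * cis t)) = vfun (of_real r' * cis t)"
        using * a by (intro Re_vhol Re_pos; simp)+
      ultimately have "\<bar>vfun (of_real r * cis s) - vfun (of_real r' * cis t)\<bar>
          \<le> L * cmod (of_real r * cis s - of_real r' * cis t)"
        using L(2)[of "of_real r * cis s" "of_real r' * cis t"] by simp
      also have "\<dots> \<le> L' * cmod (of_real r * cis s - of_real r' * cis t)"
        using L' by (intro mult_right_mono) auto
      finally show "\<bar>vfun (of_real r * cis s) - vfun (of_real r' * cis t)\<bar>
          \<le> L' * cmod (of_real r * cis s - of_real r' * cis t)" .
    qed (use a b c L L' increase outer in auto)
    thus "ray_increasing vfun {- \<beta>..\<beta>} a b (2 * cos \<beta>) d L'"
      by (simp add: c_def)
  qed (use \<alpha> in auto)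
qed

lemma Tset_polar:
  assumes "0 < d1" "d1 < 1"
  shows "Tset d1 d2 = {y. \<exists>r t. 0 < r \<and> t \<in> {- (pi / 2 - d1)..pi / 2 - d1}
    \<and> y = of_real r * cis t \<and> \<bar>vfun y\<bar> \<le> d2}"
proof (intro equalityI subsetI)
  fix y
  assume y: "y \<in> Tset d1 d2"
  hence y0: "y \<noteq> 0" and arg: "\<bar>Arg y\<bar> \<le> pi / 2 - d1"
    by (auto simp: Tset_def)
  have eq: "y = of_real (cmod y) * cis (Arg y)"
    using y0 by (simp add: cis_Arg sgn_eq)
  have "0 < Re (of_real (cmod y) * cis (Arg y))"
    using y0 arg assms by (intro Re_polar_pos) auto
  hence "\<bar>vfun y\<bar> \<le> d2"
    using y Re_V_pfun[of y] eq by (simp add: Tset_def)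
  thus "y \<in> {y. \<exists>r t. 0 < r \<and> t \<in> {- (pi / 2 - d1)..pi / 2 - d1}
      \<and> y = of_real r * cis t \<and> \<bar>vfun y\<bar> \<le> d2}"
    using eq y0 arg by (intro CollectI exI[of _ "cmod y"] exI[of _ "Arg y"]) auto
next
  fix y
  assume "y \<in> {y. \<exists>r t. 0 < r \<and> t \<in> {- (pi / 2 - d1)..pi / 2 - d1}
      \<and> y = of_real r * cis t \<and> \<bar>vfun y\<bar> \<le> d2}"
  then obtain r t where rt: "0 < r" "t \<in> {- (pi / 2 - d1)..pi / 2 - d1}"
    "y = of_real r * cis t" "\<bar>vfun y\<bar> \<le> d2"
    by auto
  have "Arg (cis t) = t"
    using rt assms pi_gt_zero by (intro Arg_cis) auto
  hence "Arg y = t"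
    using rt by simp
  moreover have "0 < Re y"
    unfolding rt(3) using rt(1,2) assms by (intro Re_polar_pos) auto
  ultimately show "y \<in> Tset d1 d2"
    using rt Re_V_pfun[of y] by (auto simp: Tset_def)
qed

lemma Re_pos_of_Tset:
  assumes "0 < d1" "d1 < 1" "y \<in> Tset d1 d2"
  shows "0 < Re y"
proof -
  obtain r t where "0 < r" "t \<in> {- (pi / 2 - d1)..pi / 2 - d1}" "y = of_real r * cis t"
    using assms(3) unfolding Tset_polar[OF assms(1,2)] by auto
  thus ?thesis
    using Re_polar_pos[of r t] assms(1) by auto
qed


section \<open>Zeros and poles of quotients\<close>

text \<open>Division by zero yields zero, so a zero of the denominator must be excluded as the source of
  a zero of the quotient. This is where isolatedness enters: the quotient is nonzero near \<open>y\<close>,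
  hence so is the denominator, and the numerator can be recovered from the quotient.\<close>
lemma isolated_zero_quotient:
  fixes g N D :: "complex \<Rightarrow> complex"
  assumes "isCont g y" "isCont N y" "isCont D y" "g y \<noteq> 0"
    and "isolated_zero (\<lambda>x. g x * (N x / D x)) y"
  shows "N y = 0"
proof -
  have "(\<lambda>x. g x * (N x / D x) * (D x / g x)) \<midarrow>y\<rightarrow> 0 * (D y / g y)"
    using assms unfolding isolated_zero_def isCont_def by (intro tendsto_intros) auto
  moreover have "eventually (\<lambda>x. g x * (N x / D x) * (D x / g x) = N x) (at y)"
    using assms(5) unfolding isolated_zero_def by (auto elim!: eventually_mono)
  ultimately have "N \<midarrow>y\<rightarrow> 0"
    using tendsto_cong by force
  thus ?thesis
    using assms(2) LIM_unique unfolding isCont_def by blast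
qed

lemma is_pole_quotient:
  fixes g N D :: "complex \<Rightarrow> complex"
  assumes "isCont g y" "isCont N y" "isCont D y"
    and "is_pole (\<lambda>x. g x * (N x / D x)) y"
  shows "D y = 0"
proof (rule ccontr)
  assume "D y \<noteq> 0"
  hence "(\<lambda>x. g x * (N x / D x)) \<midarrow>y\<rightarrow> g y * (N y / D y)"
    using assms(1-3) unfolding isCont_def by (intro tendsto_intros) auto
  thus False
    using assms(4) not_tendsto_and_filterlim_at_infinity[OF trivial_limit_at]
    unfolding is_pole_def by blast
qed

lemma isolated_zero_reflect:
  fixes f :: "complex \<Rightarrow> complex"
  assumes "isolated_zero (\<lambda>y. inverse (f (- y))) y"
  shows "is_pole f (- y)"
proof -
  have "filterlim (\<lambda>x. inverse (f (- x))) (at 0) (at y)"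
    using assms unfolding isolated_zero_def filterlim_at by auto
  hence "filterlim (\<lambda>x. f (- x)) at_infinity (at y)"
    by (simp add: filterlim_inverse_at_iff)
  hence "filterlim f at_infinity (filtermap uminus (at y))"
    by (simp add: filterlim_filtermap)
  thus ?thesis
    by (simp add: is_pole_def filtermap_at_minus)
qed

lemma is_pole_reflect:
  fixes f :: "complex \<Rightarrow> complex"
  assumes "is_pole (\<lambda>y. inverse (f (- y))) y"
  shows "isolated_zero f (- y)"
proof -
  have "filterlim (\<lambda>x. inverse (f (- x))) at_infinity (at y)"
    using assms unfolding is_pole_def .
  hence "filterlim (\<lambda>x. f (- x)) (at 0) (at y)"
    using filterlim_inverse_at_iff[of "\<lambda>x. inverse (f (- x))"] by simp
  hence "filterlim f (at 0) (filtermap uminus (at y))"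
    by (simp add: filterlim_filtermap)
  thus ?thesis
    by (simp add: isolated_zero_def filtermap_at_minus filterlim_at)
qed

lemma isCont_pfun:
  assumes "0 < Re y"
  shows "isCont pfun y" "isCont (\<lambda>y. inverse (pfun y)) y"
proof -
  have opn: "open {y. 0 < Re y}"
    by (rule open_halfspace_Re_gt)
  have "continuous_on {y. 0 < Re y} pfun \<longleftrightarrow>
      continuous_on {y. 0 < Re y} (\<lambda>y. \<i> / y * (1 / 2 - yroot y))"
    by (intro continuous_on_cong refl pfun_eq) auto
  moreover have "continuous_on {y. 0 < Re y} (\<lambda>y. \<i> / y * (1 / 2 - yroot y))"
    by (intro continuous_intros holomorphic_on_imp_continuous_on yroot_holomorphic) auto
  ultimately show 1: "isCont pfun y"
    using assms opn by (simp add: continuous_on_eq_continuous_at)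
  show "isCont (\<lambda>y. inverse (pfun y)) y"
    using 1 pfun_nonzero[OF assms] by (intro continuous_intros)
qed

text \<open>The principal logarithm in \<open>Vfun\<close> disappears because the exponent contains it with an integer
  factor; the right-hand side is visibly continuous.\<close>
lemma expV_eq:
  assumes "0 < Re y"
  shows "expV n y = (pfun y * exp (2 * yroot y)) ^ (2 * n)"
proof -
  have "\<i> * y * (inverse (pfun y) - pfun y) = - (2 * yroot y)"
    using assms unfolding pfun_diff[OF assms] by auto
  hence "Vfun (inverse (pfun y)) y = - Ln (inverse (pfun y)) + 2 * yroot y"
    by (simp add: Vfun_def)
  moreover have "exp (- Ln (inverse (pfun y)) + 2 * yroot y) = pfun y * exp (2 * yroot y)"
    using pfun_nonzero[OF assms] by (simp only: exp_add exp_minus exp_Ln inverse_inverse_eq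
        nonzero_imp_inverse_nonzero not_False_eq_True)
  moreover have "expV n y = exp (Vfun (inverse (pfun y)) y) ^ (2 * n)"
    unfolding expV_def exp_of_nat_mult[symmetric] by simp
  ultimately show ?thesis
    by simp
qed

lemma isCont_expV:
  assumes "0 < Re y"
  shows "isCont (expV n) y"
proof -
  have opn: "open {y. 0 < Re y}"
    by (rule open_halfspace_Re_gt)
  have "continuous_on {y. 0 < Re y} (expV n) \<longleftrightarrow>
      continuous_on {y. 0 < Re y} (\<lambda>y. (pfun y * exp (2 * yroot y)) ^ (2 * n))"
    by (intro continuous_on_cong refl expV_eq) auto
  moreover have "continuous_on {y. 0 < Re y} pfun"
    using isCont_pfun(1) by (auto intro!: continuous_at_imp_continuous_on)
  hence "continuous_on {y. 0 < Re y} (\<lambda>y. (pfun y * exp (2 * yroot y)) ^ (2 * n))"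
    using holomorphic_on_imp_continuous_on[OF yroot_holomorphic] by (intro continuous_intros)
  ultimately show ?thesis
    using assms opn by (simp add: continuous_on_eq_continuous_at)
qed

lemma norm_expV: "cmod (expV n y) = exp (2 * real n * vfun y)"
proof -
  have "Re (2 * of_nat n * z) = 2 * real n * Re z" for z
    by simp
  thus ?thesis
    by (simp add: expV_def vfun_def)
qed

lemma pfun_sum_diff_nonzero:
  assumes "0 < Re y"
  shows "inverse (pfun y) + pfun y \<noteq> 0" "inverse (pfun y) - pfun y \<noteq> 0"
  unfolding pfun_sum[OF assms] pfun_diff[OF assms]
  using assms Re_yroot_pos[OF assms] by fastforce+

lemma isCont_Gfun:
  assumes "0 < Re y"
  shows "isCont (Gfun k n j) y"
  unfolding Gfun_def[abs_def]
  by (rule isCont_mult isCont_add isCont_diff continuous_const continuous_at_within_power_int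
      isCont_pfun pfun_sum_diff_nonzero assms)+

lemma isCont_Ffun:
  assumes "0 < Re y"
  shows "isCont (Ffun k n j) y"
  unfolding Ffun_def[abs_def]
  by (rule isCont_mult isCont_add isCont_diff continuous_const continuous_at_within_power_int
      isCont_pfun pfun_sum_diff_nonzero assms)+

lemma norm_Gfun: "cmod (Gfun k n j y) = Ulevel k n j y"
proof -
  have *: "6 * int j - 3 * int k = - (3 * int k - 6 * int j)"
    "2 * int j - int k = - (int k - 2 * int j)"
    by simp_all
  show ?thesis
    unfolding Gfun_def Ulevel_def * power_int_minus
    by (simp only: norm_mult norm_power norm_divide norm_inverse norm_power_int norm_minus_cancel
        norm_ii norm_one norm_of_nat norm_fact power_one mult_1 divide_inverse
        inverse_mult_distrib mult.assoc mult.left_commute mult.commute)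
qed

lemma norm_Ffun: "cmod (Ffun k n l y) = Wlevel k n l y"
proof -
  have *: "6 * int l - 3 * int k - 3 = - (3 * int k - 6 * int l + 3)"
    "2 * int l - int k - 1 = - (int k - 2 * int l + 1)"
    by simp_all
  show ?thesis
    unfolding Ffun_def Wlevel_def * power_int_minus
    by (simp only: norm_mult norm_power norm_divide norm_inverse norm_power_int norm_minus_cancel
        norm_ii norm_one norm_of_nat norm_fact power_one mult_1 divide_inverse
        inverse_mult_distrib mult.assoc mult.left_commute mult.commute)
qed

lemma Ufun_zero:
  assumes "0 < Re y" "isolated_zero (Ufun k n j) y"
  shows "exp (2 * real n * vfun y) = Ulevel k n j y * inverse (cmod (pfun y))"
proof -
  have "expV n y - inverse (pfun y) * Gfun k n j y = 0"
    by (rule isolated_zero_quotient[OF _ _ _ _ assms(2)[unfolded Ufun_def[abs_def]]];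
        ((rule isCont_mult isCont_diff continuous_const isCont_pfun isCont_expV isCont_Gfun
          isCont_Ffun assms(1))+)?)
      (simp add: pfun_nonzero[OF assms(1)])
  hence "cmod (expV n y) = cmod (inverse (pfun y) * Gfun k n j y)"
    by simp
  thus ?thesis
    by (simp only: norm_expV norm_mult norm_Gfun norm_inverse mult.commute)
qed

lemma Ufun_pole:
  assumes "0 < Re y" "is_pole (Ufun k n j) y"
  shows "exp (2 * real n * vfun y) = Ulevel k n j y * cmod (pfun y)"
proof -
  have "expV n y - pfun y * Gfun k n j y = 0"
    by (rule is_pole_quotient[OF _ _ _ assms(2)[unfolded Ufun_def[abs_def]]];
        ((rule isCont_mult isCont_diff continuous_const isCont_pfun isCont_expV isCont_Gfun
          isCont_Ffun assms(1))+)?)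
  hence "cmod (expV n y) = cmod (pfun y * Gfun k n j y)"
    by simp
  thus ?thesis
    by (simp only: norm_expV norm_mult norm_Gfun mult.commute)
qed

lemma Wfun_zero:
  assumes "0 < Re y" "isolated_zero (Wfun k n l) y"
  shows "exp (2 * real n * vfun y) = Wlevel k n l y * cmod (pfun y)"
proof -
  have "expV n y - pfun y * Ffun k n l y = 0"
    by (rule isolated_zero_quotient[OF _ _ _ _ assms(2)[unfolded Wfun_def[abs_def]]];
        ((rule isCont_mult isCont_diff continuous_const isCont_pfun isCont_expV isCont_Gfun
          isCont_Ffun assms(1))+)?)
      (simp add: pfun_nonzero[OF assms(1)])
  hence "cmod (expV n y) = cmod (pfun y * Ffun k n l y)"
    by simp
  thus ?thesis
    by (simp only: norm_expV norm_mult norm_Ffun mult.commute)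
qed

lemma Wfun_pole:
  assumes "0 < Re y" "is_pole (Wfun k n l) y"
  shows "exp (2 * real n * vfun y) = Wlevel k n l y * inverse (cmod (pfun y))"
proof -
  have "expV n y - inverse (pfun y) * Ffun k n l y = 0"
    by (rule is_pole_quotient[OF _ _ _ assms(2)[unfolded Wfun_def[abs_def]]];
        ((rule isCont_mult isCont_diff continuous_const isCont_pfun isCont_expV isCont_Gfun
          isCont_Ffun assms(1))+)?)
  hence "cmod (expV n y) = cmod (inverse (pfun y) * Ffun k n l y)"
    by simp
  thus ?thesis
    by (simp only: norm_expV norm_mult norm_Ffun norm_inverse mult.commute)
qed


section \<open>Zeros and poles lie on the curves\<close>

lemma lev_antimono:
  assumes "1 \<le> n" "c \<le> c'"
  shows "lev n c' \<le> lev n c"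
proof -
  have "0 \<le> ln (real n) / real n"
    using assms(1) by simp
  hence "c * (ln (real n) / real n) \<le> c' * (ln (real n) / real n)"
    using assms(2) by (intro mult_right_mono)
  thus ?thesis
    unfolding lev_def mult.assoc by linarith
qed

lemma in_Udom_left:
  assumes "1 \<le> n" "vfun y \<le> lev n c" "real k - 1 / 2 \<le> c"
  shows "y \<in> Udom k n 0"
  using assms lev_antimono[OF assms(1,3)] by (simp add: Udom_def)

lemma in_Udom_middle:
  assumes "1 \<le> n" "lev n c' \<le> vfun y" "vfun y \<le> lev n c"
    and "c' \<le> real k - 2 * real l + 1 / 2" "real k - 2 * real l - 1 / 2 \<le> c"
  shows "y \<in> Udom k n l"
  using assms(2,3) lev_antimono[OF assms(1,4)] lev_antimono[OF assms(1,5)]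
  by (auto simp: Udom_def)

lemma in_Udom_right:
  assumes "1 \<le> n" "lev n c \<le> vfun y" "c \<le> - real k + 1 / 2"
  shows "y \<in> Udom k n k"
proof -
  have "lev n (- real k + 1 / 2) \<le> vfun y"
    using assms(2) lev_antimono[OF assms(1,3)] by linarith
  moreover have "1 / 2 * (real k + 1 / 2) * (ln (real n) / real n) = lev n (- real k - 1 / 2)"
    by (simp add: lev_def algebra_simps)
  moreover have "real k - 2 * real k + 1 / 2 = - real k + 1 / 2"
    "real k - 2 * real k - 1 / 2 = - real k - 1 / 2"
    by simp_all
  ultimately show ?thesis
    unfolding Udom_def by (auto simp: not_le)
qed

text \<open>The regions on which \<open>udot\<close> uses one formula refine the sub-domains on which the curves are
  defined: the sub-domain of \<open>Ufun k n l\<close> is the union of the two regions to the left and to the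
  right of the level \<open>lev n (k - 2 * l)\<close>.\<close>
lemma udot_cases:
  assumes "1 \<le> n" "(D, f) \<in> udot k n" "y \<in> D"
  obtains (U) l where "l \<le> k" "f = Ufun k n l" "y \<in> Udom k n l"
    | (W) l where "1 \<le> l" "l \<le> k" "f = Wfun k n l" "y \<in> Wdom k n l"
proof -
  from assms(2) consider
      (left) "D = {y. vfun y \<le> lev n (real k)}" "f = Ufun k n 0"
    | (right) "D = {y. vfun y \<ge> lev n (- real k)}" "f = Ufun k n k"
    | (U1) l where "1 \<le> l" "l \<le> k" "f = Ufun k n (l - 1)"
        "D = {y. lev n (real k - 2 * real l + 2) \<le> vfun y
          \<and> vfun y \<le> lev n (real k - 2 * real l + 3 / 2)}"
    | (W) l where "1 \<le> l" "l \<le> k" "f = Wfun k n l"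
        "D = {y. lev n (real k - 2 * real l + 3 / 2) \<le> vfun y
          \<and> vfun y \<le> lev n (real k - 2 * real l + 1 / 2)}"
    | (U2) l where "1 \<le> l" "l \<le> k" "f = Ufun k n l"
        "D = {y. lev n (real k - 2 * real l + 1 / 2) \<le> vfun y
          \<and> vfun y \<le> lev n (real k - 2 * real l)}"
    unfolding udot_def by auto
  thus thesis
  proof cases
    case left
    thus thesis
      using assms(3) by (intro U[of 0] in_Udom_left[OF assms(1)]) auto
  next
    case right
    thus thesis
      using assms(3) by (intro U[of k] in_Udom_right[OF assms(1)]) auto
  next
    case U1
    thus thesis
      using assms(3) by (intro U[of "l - 1"] in_Udom_middle[OF assms(1)]) (auto simp: of_nat_diff)
  next
    case W
    thus thesis
      using assms(3) that(2) by (auto simp: Wdom_def)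
  next
    case U2
    thus thesis
      using assms(3) by (intro U[of l] in_Udom_middle[OF assms(1)]) auto
  qed
qed

lemma U_curves_in_curves:
  assumes "l \<le> k"
  shows "(Zeros, {y \<in> T. y \<in> Udom k n l
      \<and> exp (2 * real n * vfun y) = Ulevel k n l y * inverse (cmod (pfun y))}) \<in> set (curves T k n)"
    and "(Poles, {y \<in> T. y \<in> Udom k n l
      \<and> exp (2 * real n * vfun y) = Ulevel k n l y * cmod (pfun y)}) \<in> set (curves T k n)"
proof -
  consider "l = 0" | "l \<in> set [1..<Suc k]"
    using assms by fastforce
  hence "(Zeros, {y \<in> T. y \<in> Udom k n l
      \<and> exp (2 * real n * vfun y) = Ulevel k n l y * inverse (cmod (pfun y))}) \<in> set (curves T k n)
    \<and> (Poles, {y \<in> T. y \<in> Udom k n l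
      \<and> exp (2 * real n * vfun y) = Ulevel k n l y * cmod (pfun y)}) \<in> set (curves T k n)"
  proof cases
    case 1
    thus ?thesis
      by (simp add: curves_def)
  next
    case 2
    show ?thesis
      unfolding curves_def set_append set_concat set_map
      by (intro conjI UnI2 UN_I[OF imageI[OF 2]]) (simp_all)
  qed
  thus "(Zeros, {y \<in> T. y \<in> Udom k n l
      \<and> exp (2 * real n * vfun y) = Ulevel k n l y * inverse (cmod (pfun y))}) \<in> set (curves T k n)"
    "(Poles, {y \<in> T. y \<in> Udom k n l
      \<and> exp (2 * real n * vfun y) = Ulevel k n l y * cmod (pfun y)}) \<in> set (curves T k n)"
    by blast+
qed

lemma W_curves_in_curves:
  assumes "1 \<le> l" "l \<le> k"
  shows "(Zeros, {y \<in> T. y \<in> Wdom k n l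
      \<and> exp (2 * real n * vfun y) = Wlevel k n l y * cmod (pfun y)}) \<in> set (curves T k n)"
    and "(Poles, {y \<in> T. y \<in> Wdom k n l
      \<and> exp (2 * real n * vfun y) = Wlevel k n l y * inverse (cmod (pfun y))}) \<in> set (curves T k n)"
proof -
  have l: "l \<in> set [1..<Suc k]"
    using assms by (auto simp: less_Suc_eq_le simp del: upt_Suc)
  show "(Zeros, {y \<in> T. y \<in> Wdom k n l
      \<and> exp (2 * real n * vfun y) = Wlevel k n l y * cmod (pfun y)}) \<in> set (curves T k n)"
    "(Poles, {y \<in> T. y \<in> Wdom k n l
      \<and> exp (2 * real n * vfun y) = Wlevel k n l y * inverse (cmod (pfun y))}) \<in> set (curves T k n)"
    unfolding curves_def set_append set_concat set_map
    by (intro UnI2 UN_I[OF imageI[OF l]]; simp)+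
qed

text \<open>A zero or pole satisfies an equation between the complex numbers \<open>expV n y\<close> and a power of
  \<open>pfun y\<close> times \<open>Gfun\<close> or \<open>Ffun\<close>. The equation of the curve is the equality of the absolute
  values.\<close>
lemma zeros_poles_lie_on_curves:
  assumes "1 \<le> n" "\<And>y. y \<in> T \<Longrightarrow> 0 < Re y"
  shows "zeros_poles_lie_on (udot k n) T (curves T k n)"
  unfolding zeros_poles_lie_on_def
proof (intro ballI conjI impI)
  fix y
  assume y: "y \<in> T" and "pw_zero (udot k n) y"
  then obtain D f where f: "(D, f) \<in> udot k n" "y \<in> D" "isolated_zero f y"
    by (auto simp: pw_zero_def)
  from assms(1) f(1,2) show "\<exists>c. (Zeros, c) \<in> set (curves T k n) \<and> y \<in> c"
  proof (cases rule: udot_cases)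
    case (U l)
    thus ?thesis
      using U_curves_in_curves(1)[OF U(1)] Ufun_zero[OF assms(2)[OF y]] f(3) y by blast
  next
    case (W l)
    thus ?thesis
      using W_curves_in_curves(1)[OF W(1,2)] Wfun_zero[OF assms(2)[OF y]] f(3) y by blast
  qed
next
  fix y
  assume y: "y \<in> T" and "pw_pole (udot k n) y"
  then obtain D f where f: "(D, f) \<in> udot k n" "y \<in> D" "is_pole f y"
    by (auto simp: pw_pole_def)
  from assms(1) f(1,2) show "\<exists>c. (Poles, c) \<in> set (curves T k n) \<and> y \<in> c"
  proof (cases rule: udot_cases)
    case (U l)
    thus ?thesis
      using U_curves_in_curves(2)[OF U(1)] Ufun_pole[OF assms(2)[OF y]] f(3) y by blast
  next
    case (W l)
    thus ?thesis
      using W_curves_in_curves(2)[OF W(1,2)] Wfun_pole[OF assms(2)[OF y]] f(3) y by blast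
  qed
qed

lemma zeros_poles_lie_on_reflect:
  assumes "zeros_poles_lie_on P T cs"
  shows "zeros_poles_lie_on (reflect_pieces P) (uminus ` T) (reflect_curves cs)"
  unfolding zeros_poles_lie_on_def
proof (intro ballI conjI impI)
  fix y
  assume y: "y \<in> uminus ` T" and "pw_zero (reflect_pieces P) y"
  then obtain D f where "(D, f) \<in> P" "- y \<in> D" "isolated_zero (\<lambda>y. inverse (f (- y))) y"
    by (fastforce simp: pw_zero_def reflect_pieces_def)
  hence "pw_pole P (- y)"
    using isolated_zero_reflect by (fastforce simp: pw_pole_def)
  moreover have "- y \<in> T"
    using y by auto
  ultimately obtain c where c: "(Poles, c) \<in> set cs" "- y \<in> c"
    using assms unfolding zeros_poles_lie_on_def by blast
  have "(Zeros, uminus ` c) \<in> set (reflect_curves cs)"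
    unfolding reflect_curves_def set_map by (rule image_eqI[OF _ c(1)]) simp
  moreover have "y \<in> uminus ` c"
    using c(2) by (intro image_eqI[of _ _ "- y"]) auto
  ultimately show "\<exists>c. (Zeros, c) \<in> set (reflect_curves cs) \<and> y \<in> c"
    by blast
next
  fix y
  assume y: "y \<in> uminus ` T" and "pw_pole (reflect_pieces P) y"
  then obtain D f where "(D, f) \<in> P" "- y \<in> D" "is_pole (\<lambda>y. inverse (f (- y))) y"
    by (fastforce simp: pw_pole_def reflect_pieces_def)
  hence "pw_zero P (- y)"
    using is_pole_reflect by (fastforce simp: pw_zero_def)
  moreover have "- y \<in> T"
    using y by auto
  ultimately obtain c where c: "(Zeros, c) \<in> set cs" "- y \<in> c"
    using assms unfolding zeros_poles_lie_on_def by blast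
  have "(Poles, uminus ` c) \<in> set (reflect_curves cs)"
    unfolding reflect_curves_def set_map by (rule image_eqI[OF _ c(1)]) simp
  moreover have "y \<in> uminus ` c"
    using c(2) by (intro image_eqI[of _ _ "- y"]) auto
  ultimately show "\<exists>c. (Poles, c) \<in> set (reflect_curves cs) \<and> y \<in> c"
    by blast
qed

section \<open>The curves as perturbed level sets of v\<close>

text \<open>The sub-domains are numbered by \<open>j = 0, ..., 2 * k\<close> from left to right: number \<open>2 * l\<close> belongs to
  \<open>Ufun k n l\<close> and number \<open>2 * l - 1\<close> to \<open>Wfun k n l\<close>. With this numbering both families of curve
  equations take the same form after passing to logarithms, the power of \<open>n\<close> being
  \<open>n powi (j - k)\<close>. Here \<open>s = 1\<close> stands for the factor \<open>\<bar>p\<bar>\<close> and \<open>s = -1\<close> for its inverse.\<close>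
definition shift :: "nat \<Rightarrow> nat \<Rightarrow> real \<Rightarrow> complex \<Rightarrow> real" where
  "shift k j s y = ln (fact (k - (j + 1) div 2) / fact (j div 2))
     + (real k - real j) * (2 * ln (cmod y) - ln 8 - 3 * ln (cmod (yroot y)))
     + s * ln (cmod (pfun y))"

lemma ln_power_int:
  fixes x :: real
  assumes "0 < x"
  shows "ln (x powi m) = of_int m * ln x"
  using assms by (simp add: ln_powr flip: powr_real_of_int')

lemma ln_norm_pfun_sum_diff:
  assumes "0 < Re y"
  shows "ln (cmod (inverse (pfun y) + pfun y)) = - ln (cmod y)"
    and "ln (cmod (inverse (pfun y) - pfun y)) = ln 2 + ln (cmod (yroot y)) - ln (cmod y)"
proof -
  have "y \<noteq> 0" "yroot y \<noteq> 0"
    using assms Re_yroot_pos[OF assms] by auto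
  thus "ln (cmod (inverse (pfun y) + pfun y)) = - ln (cmod y)"
    "ln (cmod (inverse (pfun y) - pfun y)) = ln 2 + ln (cmod (yroot y)) - ln (cmod y)"
    unfolding pfun_sum[OF assms] pfun_diff[OF assms]
    by (simp_all add: norm_divide norm_mult ln_div ln_mult)
qed

lemma ln_8: "ln (8 :: real) = 3 * ln 2"
  using ln_realpow[of 2 3] by simp

lemma Ulevel_ln:
  assumes "0 < Re y" "1 \<le> n"
  shows "0 < Ulevel k n l y"
    and "ln (Ulevel k n l y) = shift k (2 * l) 0 y - (real k - 2 * real l) * ln (real n)"
proof -
  have pos: "0 < cmod (inverse (pfun y) + pfun y)" "0 < cmod (inverse (pfun y) - pfun y)" "0 < real n"
    using pfun_sum_diff_nonzero[OF assms(1)] assms(2) by auto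
  note pos' = pos[THEN zero_less_power_int]
  show "0 < Ulevel k n l y"
    unfolding Ulevel_def by (intro divide_pos_pos mult_pos_pos pos' fact_gt_zero)
  have "ln (Ulevel k n l y)
      = ln (fact (k - l) / fact l) + (real k - 2 * real l) * ln (cmod (inverse (pfun y) + pfun y))
        - (real k - 2 * real l) * ln (real n)
        - (3 * real k - 6 * real l) * ln (cmod (inverse (pfun y) - pfun y))"
    unfolding Ulevel_def using pos pos'
    by (simp add: ln_div ln_mult ln_power_int)
  thus "ln (Ulevel k n l y) = shift k (2 * l) 0 y - (real k - 2 * real l) * ln (real n)"
    unfolding ln_norm_pfun_sum_diff[OF assms(1)] by (simp add: shift_def ln_8 algebra_simps)
qed

lemma Wlevel_ln:
  assumes "0 < Re y" "1 \<le> n" "1 \<le> l"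
  shows "0 < Wlevel k n l y"
    and "ln (Wlevel k n l y) = shift k (2 * l - 1) 0 y - (real k - 2 * real l + 1) * ln (real n)"
proof -
  have pos: "0 < cmod (inverse (pfun y) + pfun y)" "0 < cmod (inverse (pfun y) - pfun y)" "0 < real n"
    using pfun_sum_diff_nonzero[OF assms(1)] assms(2) by auto
  note pos' = pos[THEN zero_less_power_int]
  show "0 < Wlevel k n l y"
    unfolding Wlevel_def by (intro divide_pos_pos mult_pos_pos pos' fact_gt_zero)
  have "ln (Wlevel k n l y)
      = ln (fact (k - l) / fact (l - 1))
        + (real k - 2 * real l + 1) * ln (cmod (inverse (pfun y) + pfun y))
        - (real k - 2 * real l + 1) * ln (real n)
        - (3 * real k - 6 * real l + 3) * ln (cmod (inverse (pfun y) - pfun y))"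
    unfolding Wlevel_def using pos pos'
    by (simp add: ln_div ln_mult ln_power_int)
  moreover have "(2 * l - 1 + 1) div 2 = l" "(2 * l - 1) div 2 = l - 1"
    "real (2 * l - 1) = 2 * real l - 1"
    using assms(3) by (auto simp: of_nat_diff)
  ultimately show "ln (Wlevel k n l y)
      = shift k (2 * l - 1) 0 y - (real k - 2 * real l + 1) * ln (real n)"
    unfolding ln_norm_pfun_sum_diff[OF assms(1)] by (simp add: shift_def ln_8 algebra_simps)
qed

text \<open>The index \<open>i = 0, ..., 4 * k + 1\<close> runs through the curves from left to right; each sub-domain
  \<open>i div 2\<close> carries two of them, the one with factor \<open>\<bar>p\<bar>\<close> first.\<close>
definition level_set :: "complex set \<Rightarrow> nat \<Rightarrow> nat \<Rightarrow> nat \<Rightarrow> complex set" where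
  "level_set T k n i = {y \<in> T. vfun y = lev n (real k - real (i div 2))
     + 1 / (2 * real n) * shift k (i div 2) (if even i then 1 else - 1) y}"

lemma exp_eq_iff_vfun_eq:
  assumes "1 \<le> n" "0 < X" "0 < P" "ln X = S - c * ln (real n)"
  shows "exp (2 * real n * v) = X * P \<longleftrightarrow> v = lev n c + 1 / (2 * real n) * (S + ln P)"
proof -
  have "exp (2 * real n * v) = X * P \<longleftrightarrow> 2 * real n * v = ln (X * P)"
    using assms(2,3) by (metis exp_ln ln_exp mult_pos_pos)
  also have "ln (X * P) = S + ln P - c * ln (real n)"
    using assms by (simp add: ln_mult)
  also have "2 * real n * v = S + ln P - c * ln (real n) \<longleftrightarrow>
      v = lev n c + 1 / (2 * real n) * (S + ln P)"
  proof -
    have "S + ln P - c * ln (real n) = 2 * real n * (lev n c + 1 / (2 * real n) * (S + ln P))"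
      using assms(1) by (simp add: lev_def field_simps)
    thus ?thesis
      using assms(1) by (simp only: mult_cancel_left) simp
  qed
  finally show ?thesis .
qed

lemma U_equation_iff:
  assumes "0 < Re y" "1 \<le> n"
  shows "exp (2 * real n * vfun y) = Ulevel k n l y * cmod (pfun y) \<longleftrightarrow>
      vfun y = lev n (real k - real (2 * l)) + 1 / (2 * real n) * shift k (2 * l) 1 y"
    and "exp (2 * real n * vfun y) = Ulevel k n l y * inverse (cmod (pfun y)) \<longleftrightarrow>
      vfun y = lev n (real k - real (2 * l)) + 1 / (2 * real n) * shift k (2 * l) (- 1) y"
  using exp_eq_iff_vfun_eq[OF assms(2) Ulevel_ln(1)[OF assms] _ Ulevel_ln(2)[OF assms],
      of "cmod (pfun y)" "vfun y" k l]
    exp_eq_iff_vfun_eq[OF assms(2) Ulevel_ln(1)[OF assms] _ Ulevel_ln(2)[OF assms],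
      of "inverse (cmod (pfun y))" "vfun y" k l] pfun_nonzero[OF assms(1)]
  by (simp_all add: ln_inverse shift_def)

lemma W_equation_iff:
  assumes "0 < Re y" "1 \<le> n" "1 \<le> l"
  shows "exp (2 * real n * vfun y) = Wlevel k n l y * cmod (pfun y) \<longleftrightarrow>
      vfun y = lev n (real k - real (2 * l - 1)) + 1 / (2 * real n) * shift k (2 * l - 1) 1 y"
    and "exp (2 * real n * vfun y) = Wlevel k n l y * inverse (cmod (pfun y)) \<longleftrightarrow>
      vfun y = lev n (real k - real (2 * l - 1)) + 1 / (2 * real n) * shift k (2 * l - 1) (- 1) y"
proof -
  have r: "real k - real (2 * l - 1) = real k - 2 * real l + 1"
    using assms(3) by (simp add: of_nat_diff)
  show "exp (2 * real n * vfun y) = Wlevel k n l y * cmod (pfun y) \<longleftrightarrow>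
      vfun y = lev n (real k - real (2 * l - 1)) + 1 / (2 * real n) * shift k (2 * l - 1) 1 y"
    "exp (2 * real n * vfun y) = Wlevel k n l y * inverse (cmod (pfun y)) \<longleftrightarrow>
      vfun y = lev n (real k - real (2 * l - 1)) + 1 / (2 * real n) * shift k (2 * l - 1) (- 1) y"
    unfolding r
    using exp_eq_iff_vfun_eq[OF assms(2) Wlevel_ln(1)[OF assms] _ Wlevel_ln(2)[OF assms],
        of "cmod (pfun y)" "vfun y" k]
      exp_eq_iff_vfun_eq[OF assms(2) Wlevel_ln(1)[OF assms] _ Wlevel_ln(2)[OF assms],
        of "inverse (cmod (pfun y))" "vfun y" k] pfun_nonzero[OF assms(1)]
    by (simp_all add: ln_inverse shift_def)
qed

lemma concat_map_blocks_of_4: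
  "concat (map (\<lambda>l. [f (4 * l - 2), f (4 * l - 1), f (4 * l), f (4 * l + 1)]) [1..<Suc m])
    = map f [2..<4 * m + 2]"
proof (induction m)
  case (Suc m)
  have *: "[2..<4 * Suc m + 2]
      = [2..<4 * m + 2] @ [4 * Suc m - 2, 4 * Suc m - 1, 4 * Suc m, 4 * Suc m + 1]"
    using upt_add_eq_append[of 2 "4 * m + 2" 4] by (simp add: upt_rec numeral_eq_Suc)
  have "[1..<Suc (Suc m)] = [1..<Suc m] @ [Suc m]"
    by simp
  thus ?case
    unfolding * by (simp only: map_append concat_append Suc.IH) simp
qed simp

lemma length_curves: "length (curves T k n) = 4 * k + 2"
proof -
  have "length (concat (map (\<lambda>l. [f l, g l, f' l, g' l]) [1..<Suc k])) = 4 * k"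
    for f g f' g' :: "nat \<Rightarrow> kind \<times> complex set"
    by (simp add: length_concat o_def sum_list_triv del: upt_Suc)
  thus ?thesis
    unfolding curves_def by (simp only: length_append list.size)
qed

text \<open>For large \<open>n\<close> the restriction to a sub-domain holds automatically: a sub-domain extends at least
  \<open>ln n / (4 * n)\<close> in \<open>v\<close> to either side of its central level \<open>lev n (k - j)\<close>, whereas the
  solutions of the equation are within \<open>M / (2 * n)\<close> of that level.\<close>
lemma map_snd_curves:
  assumes "1 \<le> n" "\<And>y. y \<in> T \<Longrightarrow> 0 < Re y"
    and M: "\<And>y i. y \<in> T \<Longrightarrow> i < 4 * k + 2 \<Longrightarrow>
      \<bar>shift k (i div 2) (if even i then 1 else - 1) y\<bar> \<le> M"
    and "2 * M \<le> ln (real n)"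
  shows "map snd (curves T k n) = map (level_set T k n) [0..<4 * k + 2]"
proof -
  have near: "lev n (real k - real (i div 2) + 1 / 2) \<le> vfun y"
    "vfun y \<le> lev n (real k - real (i div 2) - 1 / 2)"
    if y: "y \<in> level_set T k n i" and i: "i < 4 * k + 2" for y i
  proof -
    let ?s = "shift k (i div 2) (if even i then 1 else - 1) y"
    have "\<bar>?s\<bar> \<le> ln (real n) / 2"
      using M[of y i] y i assms(4) by (auto simp: level_set_def)
    hence "\<bar>1 / (2 * real n) * ?s\<bar> \<le> 1 / (2 * real n) * (ln (real n) / 2)"
      unfolding abs_mult using assms(1) by (intro mult_mono) auto
    hence "\<bar>1 / (2 * real n) * ?s\<bar> \<le> 1 / 4 * (ln (real n) / real n)"
      by simp
    moreover have "vfun y = lev n (real k - real (i div 2)) + 1 / (2 * real n) * ?s"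
      using y by (simp add: level_set_def)
    moreover have "lev n (c + 1 / 2) = lev n c - 1 / 4 * (ln (real n) / real n)"
      "lev n (c - 1 / 2) = lev n c + 1 / 4 * (ln (real n) / real n)" for c
      by (simp_all add: lev_def algebra_simps)
    ultimately show "lev n (real k - real (i div 2) + 1 / 2) \<le> vfun y"
      "vfun y \<le> lev n (real k - real (i div 2) - 1 / 2)"
      by (simp_all only: abs_le_iff) linarith+
  qed
  have U: "{y \<in> T. y \<in> Udom k n l
      \<and> exp (2 * real n * vfun y) = Ulevel k n l y * cmod (pfun y)} = level_set T k n (4 * l)"
    "{y \<in> T. y \<in> Udom k n l
      \<and> exp (2 * real n * vfun y) = Ulevel k n l y * inverse (cmod (pfun y))}
        = level_set T k n (4 * l + 1)" if l: "l \<le> k" for l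
  proof -
    have ar: "4 * l div 2 = 2 * l" "(4 * l + 1) div 2 = 2 * l" "4 * l < 4 * k + 2"
      "4 * l + 1 < 4 * k + 2" "even (4 * l)" "odd (4 * l + 1)"
      using l by auto
    have dom: "y \<in> Udom k n l" if "y \<in> level_set T k n (4 * l) \<or> y \<in> level_set T k n (4 * l + 1)" for y
      using that near[of y "4 * l"] near[of y "4 * l + 1"] ar(1-4)
      by (intro in_Udom_middle[OF assms(1), of "real k - 2 * real l + 1 / 2" y
          "real k - 2 * real l - 1 / 2"]) auto
    show "{y \<in> T. y \<in> Udom k n l
        \<and> exp (2 * real n * vfun y) = Ulevel k n l y * cmod (pfun y)} = level_set T k n (4 * l)"
      using dom U_equation_iff(1)[OF assms(2) assms(1), of _ k l] ar
      by (auto simp: level_set_def)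
    show "{y \<in> T. y \<in> Udom k n l
        \<and> exp (2 * real n * vfun y) = Ulevel k n l y * inverse (cmod (pfun y))}
          = level_set T k n (4 * l + 1)"
      using dom U_equation_iff(2)[OF assms(2) assms(1), of _ k l] ar
      by (auto simp: level_set_def)
  qed
  have W: "{y \<in> T. y \<in> Wdom k n l
      \<and> exp (2 * real n * vfun y) = Wlevel k n l y * cmod (pfun y)} = level_set T k n (4 * l - 2)"
    "{y \<in> T. y \<in> Wdom k n l
      \<and> exp (2 * real n * vfun y) = Wlevel k n l y * inverse (cmod (pfun y))}
        = level_set T k n (4 * l - 1)" if l: "1 \<le> l" "l \<le> k" for l
  proof -
    have ar: "(4 * l - 2) div 2 = 2 * l - 1" "(4 * l - 1) div 2 = 2 * l - 1" "4 * l - 2 < 4 * k + 2"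
      "4 * l - 1 < 4 * k + 2" "even (4 * l - 2)" "odd (4 * l - 1)"
      using l by presburger+
    have r: "real k - real (2 * l - 1) = real k - 2 * real l + 1"
      using l by (simp add: of_nat_diff)
    have dom: "y \<in> Wdom k n l"
      if "y \<in> level_set T k n (4 * l - 2) \<or> y \<in> level_set T k n (4 * l - 1)" for y
      using that near[of y "4 * l - 2"] near[of y "4 * l - 1"] ar(3,4)
      unfolding ar(1,2) r by (auto simp: Wdom_def algebra_simps)
    show "{y \<in> T. y \<in> Wdom k n l
        \<and> exp (2 * real n * vfun y) = Wlevel k n l y * cmod (pfun y)} = level_set T k n (4 * l - 2)"
      using dom W_equation_iff(1)[OF assms(2) assms(1) l(1), of _ k] ar
      by (auto simp: level_set_def)
    show "{y \<in> T. y \<in> Wdom k n l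
        \<and> exp (2 * real n * vfun y) = Wlevel k n l y * inverse (cmod (pfun y))}
          = level_set T k n (4 * l - 1)"
      using dom W_equation_iff(2)[OF assms(2) assms(1) l(1), of _ k] ar
      by (auto simp: level_set_def)
  qed
  have "map snd (curves T k n) = [level_set T k n 0, level_set T k n 1]
      @ concat (map (\<lambda>l. [level_set T k n (4 * l - 2), level_set T k n (4 * l - 1),
          level_set T k n (4 * l), level_set T k n (4 * l + 1)]) [1..<Suc k])"
    unfolding curves_def map_append map_concat map_map o_def
    using U(1,2)[of 0]
    by (intro arg_cong2[of _ _ _ _ "(@)"] arg_cong[of _ _ concat] map_cong refl)
      (auto simp: U W less_Suc_eq_le simp del: One_nat_def upt_Suc)
  also have "\<dots> = map (level_set T k n) ([0, 1] @ [2..<4 * k + 2])"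
    by (simp only: concat_map_blocks_of_4 map_append list.map)
  also have "[0, 1] @ [2..<4 * k + 2] = [0..<4 * k + 2]"
    by (simp add: upt_conv_Cons numeral_2_eq_2)
  finally show ?thesis .
qed

lemma shift_holomorphic:
  obtains H where "H holomorphic_on {y. 0 < Re y}" "\<And>y. 0 < Re y \<Longrightarrow> Re (H y) = shift k j s y"
proof
  let ?H = "\<lambda>y. of_real (ln (fact (k - (j + 1) div 2) / fact (j div 2)))
     + of_real (real k - real j) * (2 * Ln y - of_real (ln 8) - 3 * Ln (yroot y))
     + of_real s * (Ln y - Ln (1 / 2 + yroot y))"
  have cut: "y \<notin> \<real>\<^sub>\<le>\<^sub>0" "yroot y \<notin> \<real>\<^sub>\<le>\<^sub>0" "1 / 2 + yroot y \<notin> \<real>\<^sub>\<le>\<^sub>0" if "0 < Re y" for y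
    using that Re_yroot_pos[OF that] by (auto simp: complex_nonpos_Reals_iff)
  show "?H holomorphic_on {y. 0 < Re y}"
    using cut by (intro holomorphic_intros yroot_holomorphic) auto
  show "Re (?H y) = shift k j s y" if "0 < Re y" for y
  proof -
    have "y \<noteq> 0" "yroot y \<noteq> 0" "1 / 2 + yroot y \<noteq> 0"
      using cut[OF that] by auto
    thus ?thesis
      using ln_norm_pfun[OF that] by (simp add: shift_def)
  qed
qed


section \<open>The system of curves for large n\<close>
lemma level_gap:
  assumes "j < j'" "1 \<le> n"
  shows "lev n (real k - real j) + 1 / 2 * (ln (real n) / real n) \<le> lev n (real k - real j')"
proof -
  define q where "q = ln (real n) / real n"
  have "1 * q \<le> (real j' - real j) * q"
    using assms by (intro mult_right_mono) (auto simp: q_def)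
  thus ?thesis
    unfolding lev_def q_def[symmetric] by (simp add: field_simps)
qed

lemma abs_lev_le:
  assumes "j \<le> 2 * k" "1 \<le> n"
  shows "\<bar>lev n (real k - real j)\<bar> \<le> 1 / 2 * real k * (ln (real n) / real n)"
proof -
  have "\<bar>lev n (real k - real j)\<bar> = 1 / 2 * \<bar>real k - real j\<bar> * (ln (real n) / real n)"
    using assms(2) by (simp add: lev_def abs_mult)
  also have "\<dots> \<le> 1 / 2 * real k * (ln (real n) / real n)"
    using assms by (intro mult_right_mono mult_left_mono) auto
  finally show ?thesis .
qed

text \<open>Consecutive central levels differ by \<open>ln n / (2 * n)\<close>, which for large \<open>n\<close> exceeds the differences
  of order \<open>1 / n\<close> that come from the functions \<open>shift\<close>; this orders curves from different
  sub-domains. Two curves from the same sub-domain are ordered by \<open>\<bar>p\<bar> < 1\<close>.\<close>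
lemma curves_ordered_parallel:
  assumes d: "0 < d1" "d1 < 1" "0 < d2"
  shows "\<exists>C N. \<forall>n\<ge>N. ordered_parallel_arcs vfun right_eyebrow cis
    {- (pi / 2 - d1)..pi / 2 - d1} (C * ln (real n) / real n) (C / real n)
    (map snd (curves (Tset d1 d2) k n))"
proof -
  define \<beta> where "\<beta> = pi / 2 - d1"
  define c where "c = 2 * cos \<beta>"
  have \<beta>: "0 \<le> \<beta>" "\<beta> < pi / 2"
    using d pi_gt3 by (auto simp: \<beta>_def)
  have c: "0 < c"
    using \<beta> by (auto simp: c_def intro!: cos_gt_zero_pi)
  obtain a b \<alpha> L0 where \<alpha>: "0 < \<alpha>" "\<alpha> = a * cos \<beta>"
    and ray0: "\<And>L'. L0 \<le> L' \<Longrightarrow> ray_increasing vfun {- \<beta>..\<beta>} a b c d2 L'"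
    using vfun_ray_increasing[OF \<beta>, of d2] d(3) unfolding c_def by (metis less_eq_real_def)
  define h where "h = (\<lambda>i. shift k (i div 2) (if even i then 1 else - 1))"
  have ex_L: "\<exists>L\<ge>0. (\<forall>y\<in>half_disc \<alpha> b. \<bar>h i y\<bar> \<le> L) \<and>
      (\<forall>y\<in>half_disc \<alpha> b. \<forall>y'\<in>half_disc \<alpha> b. \<bar>h i y - h i y'\<bar> \<le> L * cmod (y - y'))" for i
  proof -
    obtain H where H: "H holomorphic_on {y. 0 < Re y}" "\<And>y. 0 < Re y \<Longrightarrow> Re (H y) = h i y"
      using shift_holomorphic unfolding h_def by metis
    obtain L where L: "0 \<le> L" "\<And>y. y \<in> half_disc \<alpha> b \<Longrightarrow> \<bar>Re (H y)\<bar> \<le> L"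
      "\<And>y y'. y \<in> half_disc \<alpha> b \<Longrightarrow> y' \<in> half_disc \<alpha> b \<Longrightarrow>
        \<bar>Re (H y) - Re (H y')\<bar> \<le> L * cmod (y - y')"
      using Re_holomorphic_half_disc[OF H(1) \<alpha>(1), of b] by blast
    moreover have "Re (H y) = h i y" if "y \<in> half_disc \<alpha> b" for y
      using that \<alpha>(1) by (intro H(2)) (auto simp: half_disc_def)
    ultimately show ?thesis
      by (intro exI[of _ L]) auto
  qed
  then obtain Li where Li: "\<And>i. 0 \<le> Li i" "\<And>i y. y \<in> half_disc \<alpha> b \<Longrightarrow> \<bar>h i y\<bar> \<le> Li i"
    "\<And>i y y'. y \<in> half_disc \<alpha> b \<Longrightarrow> y' \<in> half_disc \<alpha> b \<Longrightarrow>
      \<bar>h i y - h i y'\<bar> \<le> Li i * cmod (y - y')"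
    by metis
  define m where "m = 4 * k + 2"
  \<comment> \<open>One constant bounds all perturbations and is a Lipschitz constant for them and for v.\<close>
  define L where "L = \<bar>L0\<bar> + (\<Sum>i<m. Li i)"
  have L: "L0 \<le> L" "0 \<le> L"
    using sum_nonneg[of "{..<m}" Li] Li(1) by (auto simp: L_def)
  have Li_le: "Li i \<le> L" if "i < m" for i
    using member_le_sum[of i "{..<m}" Li] that Li(1) by (auto simp: L_def)
  interpret ray_increasing vfun "{- \<beta>..\<beta>}" a b c d2 L
    using L(1) by (rule ray0)
  have polar: "of_real r * cis t \<in> half_disc \<alpha> b" if "t \<in> {- \<beta>..\<beta>}" "r \<in> {a..b}" for r t
    using that radii \<alpha> \<beta> c by (intro polar_in_half_disc[of \<beta> t a]) (auto simp: c_def)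
  have h_bound: "\<bar>h i (of_real r * cis t)\<bar> \<le> L" if "i < m" "t \<in> {- \<beta>..\<beta>}" "r \<in> {a..b}" for i r t
    using Li(2)[OF polar[OF that(2,3)], of i] Li_le[OF that(1)] by linarith
  have h_lip: "\<bar>h i (of_real r * cis s) - h i (of_real r' * cis t)\<bar>
      \<le> L * cmod (of_real r * cis s - of_real r' * cis t)"
    if "i < m" "s \<in> {- \<beta>..\<beta>}" "t \<in> {- \<beta>..\<beta>}" "r \<in> {a..b}" "r' \<in> {a..b}" for i r r' s t
    using Li(3)[OF polar[OF that(2,4)] polar[OF that(3,5)], of i]
      mult_right_mono[OF Li_le[OF that(1)], of "cmod (of_real r * cis s - of_real r' * cis t)"]
    by simp
  have strip: "strip = Tset d1 d2"
    by (simp only: strip_def Tset_polar[OF d(1,2)] flip: \<beta>_def)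
  have T_polar: "\<exists>r t. t \<in> {- \<beta>..\<beta>} \<and> r \<in> {a..b} \<and> y = of_real r * cis t" if "y \<in> Tset d1 d2" for y
    using that strip_radius unfolding strip[symmetric] strip_def by blast
  \<comment> \<open>The first summand serves the distance to the eyebrow, the second one the variation of v.\<close>
  define C where "C = (real k + L) / c + L * (b + L * b / c)"
  have C: "(real k + L) / c \<le> C" "L * (b + L * b / c) \<le> C"
    using L(2) radii c by (simp_all add: C_def)
  have "eventually (\<lambda>n. 2 * L + 1 < ln (real n)) sequentially"
    using filterlim_compose[OF ln_at_top filterlim_real_sequentially]
    by (simp add: filterlim_at_top_dense)
  moreover have "(\<lambda>n. (real k + L) * (ln (real n) / real n)) \<longlonglongrightarrow> (real k + L) * 0"
    by (intro tendsto_intros lim_ln_over_n)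
  hence "eventually (\<lambda>n. (real k + L) * (ln (real n) / real n) < min d2 c) sequentially"
    using d(3) c by (intro order_tendstoD(2)) auto
  ultimately have "eventually (\<lambda>n. 1 \<le> n \<and> 2 * L + 1 < ln (real n)
      \<and> (real k + L) * (ln (real n) / real n) < min d2 c) sequentially"
    using eventually_ge_at_top[of 1] by eventually_elim auto
  then obtain N where N: "\<And>n. N \<le> n \<Longrightarrow> 1 \<le> n \<and> 2 * L + 1 < ln (real n)
      \<and> (real k + L) * (ln (real n) / real n) < min d2 c"
    by (auto simp: eventually_sequentially)
  have "ordered_parallel_arcs vfun right_eyebrow cis {- \<beta>..\<beta>} (C * ln (real n) / real n)
      (C / real n) (map snd (curves (Tset d1 d2) k n))" if "N \<le> n" for n
  proof -
    define q where "q = ln (real n) / real n"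
    define e where "e = 1 / (2 * real n)"
    define l where "l = (\<lambda>i. lev n (real k - real (i div 2)))"
    have n: "1 \<le> n" "2 * L + 1 < ln (real n)" "(real k + L) * q < d2" "(real k + L) * q < c"
      using N[OF that] by (auto simp: q_def)
    have e: "0 \<le> e" "2 * e \<le> q" "e * (2 * L) < 1 / 2 * q"
    proof -
      show "0 \<le> e"
        by (simp add: e_def)
      show "2 * e \<le> q"
        using n(1,2) L(2) by (simp add: e_def q_def divide_right_mono)
      have "2 * L / (2 * real n) < ln (real n) / (2 * real n)"
        using n(1,2) by (intro divide_strict_right_mono) auto
      thus "e * (2 * L) < 1 / 2 * q"
        by (simp add: e_def q_def)
    qed
    have q: "0 \<le> q"
      using e by linarith
    have eL: "e * L \<le> 1 / 2 * L * q"
      using mult_right_mono[OF e(2) L(2)] by (simp add: algebra_simps)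
    have lbound: "\<bar>l i\<bar> + e * L \<le> (real k + L) * q" if "i < m" for i
    proof -
      have "\<bar>l i\<bar> \<le> 1 / 2 * real k * q"
        unfolding l_def q_def using that n(1) by (intro abs_lev_le) (auto simp: m_def)
      moreover have "0 \<le> real k * q" "0 \<le> L * q"
        using q L(2) by simp_all
      ultimately show ?thesis
        using eL by (simp add: algebra_simps)
    qed
    have level: "perturbed_level vfun {- \<beta>..\<beta>} a b c d2 L (h i) L (l i) e" if "i < m" for i
    proof
      have "0 \<le> real k * q" "0 \<le> L * q"
        using q L(2) by simp_all
      thus "e * L \<le> c / 2"
        using eL n(4) by (simp add: algebra_simps)
      show "\<bar>l i\<bar> + e * L \<le> d2"
        using lbound[OF that] n(3) by linarith
    qed (use h_lip h_bound e(1) that in auto)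
    have separated: "l i + e * h i (of_real r * cis t) < l j + e * h j (of_real r * cis t)"
      if "i < j" "j < m" "t \<in> {- \<beta>..\<beta>}" "r \<in> {a..b}" for i j r t
    proof (cases "i div 2 = j div 2")
      case True
      define y where "y = of_real r * cis t"
      have "y \<in> half_disc \<alpha> b"
        unfolding y_def using that(3,4) by (rule polar)
      hence y: "0 < Re y"
        using \<alpha>(1) by (auto simp: half_disc_def)
      have "even i" "odd j"
        using True that(1) by presburger+
      hence "h j y - h i y = - 2 * ln (cmod (pfun y))"
        using True by (simp add: h_def shift_def)
      also have "\<dots> > 0"
        using norm_pfun_less_1[OF y] pfun_nonzero[OF y] by simp
      finally have "h i y < h j y"
        by simp
      moreover have "0 < e"
        using n(1) by (simp add: e_def)
      ultimately show ?thesis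
        using True by (simp add: l_def y_def)
    next
      case False
      hence "i div 2 < j div 2"
        using that(1) div_le_mono[of i j 2] by simp
      hence "l i + 1 / 2 * q \<le> l j"
        unfolding l_def q_def using n(1) by (rule level_gap)
      moreover have "e * (h i (of_real r * cis t) - h j (of_real r * cis t)) \<le> e * (2 * L)"
        using h_bound[of i t r] h_bound[of j t r] that e(1) by (intro mult_left_mono) auto
      ultimately show ?thesis
        using e(3) by (simp add: algebra_simps)
    qed
    have eyebrow: "of_real r * cis t \<in> right_eyebrow"
      if "0 < r" "t \<in> {- \<beta>..\<beta>}" "vfun (of_real r * cis t) = 0" for r t
    proof -
      have "0 < Re (of_real r * cis t)"
        using that \<beta> by (intro Re_polar_pos) auto
      thus ?thesis
        unfolding right_eyebrow_def using that(3) Re_V_pfun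
        by (intro subsetD[OF closure_subset]) auto
    qed
    have "map snd (curves (Tset d1 d2) k n) = map (level_set (Tset d1 d2) k n) [0..<m]"
      unfolding m_def
    proof (rule map_snd_curves[OF n(1), of _ _ L])
      show "0 < Re y" if "y \<in> Tset d1 d2" for y
        using Re_pos_of_Tset[OF d(1,2) that] .
      show "\<bar>shift k (i div 2) (if even i then 1 else - 1) y\<bar> \<le> L"
        if "y \<in> Tset d1 d2" "i < 4 * k + 2" for y i
        using T_polar[OF that(1)] h_bound[of i] that(2) by (auto simp: h_def m_def)
    qed (use n(2) in simp)
    also have "\<dots> = map (\<lambda>i. {y \<in> strip. vfun y = l i + e * h i y}) [0..<m]"
      by (simp add: level_set_def strip l_def e_def h_def)
    finally have cs: "map snd (curves (Tset d1 d2) k n)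
      = map (\<lambda>i. {y \<in> strip. vfun y = l i + e * h i y}) [0..<m]" .
    show ?thesis
    proof (rule perturbed_levels_ordered_parallel[OF level separated eyebrow _ _ _ cs])
      show "\<bar>l i\<bar> + e * L \<le> c * (C * ln (real n) / real n)" if "i < m" for i
      proof -
        have "(real k + L) * q = c * ((real k + L) / c * q)"
          using c by simp
        also have "\<dots> \<le> c * (C * q)"
          using C(1) c q by (intro mult_left_mono mult_right_mono) auto
        finally show ?thesis
          using lbound[OF that] by (simp add: q_def)
      qed
      have "e * L * (2 * b + 2 * L * b / c) = L * (b + L * b / c) / real n"
        using n(1) by (simp add: e_def field_simps)
      also have "\<dots> \<le> C / real n"
        using C(2) by (intro divide_right_mono) auto
      finally show "e * L * (2 * b + 2 * L * b / c) \<le> C / real n" .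
    qed (use d(3) in auto)
  qed
  thus ?thesis
    unfolding \<beta>_def by blast
qed

theorem theorem6:
  fixes k :: nat
  shows "\<exists>d0>0. \<forall>d1 d2. 0 < d1 \<and> d1 < d0 \<and> 0 < d2 \<and> d2 < d0 \<longrightarrow>
    (let T = Tset d1 d2; A = {- (pi / 2 - d1)..pi / 2 - d1} in
      (\<forall>n\<ge>1.
         length (curves T k n) = 4 * k + 2
       \<and> zeros_poles_lie_on (udot k n) T (curves T k n)
       \<and> zeros_poles_lie_on (reflect_pieces (udot k n)) (uminus ` T)
           (reflect_curves (curves T k n)))
    \<and> (\<exists>C N. \<forall>n\<ge>N.
         ordered_parallel_arcs vfun right_eyebrow cis A
           (C * ln (real n) / real n) (C / real n) (map snd (curves T k n))
       \<and> ordered_parallel_arcs (\<lambda>y. vfun (- y)) (uminus ` right_eyebrow) (\<lambda>t. - cis t) A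
           (C * ln (real n) / real n) (C / real n)
           (map snd (reflect_curves (curves T k n)))))"
proof (intro exI[of _ 1] conjI allI impI)
  fix d1 d2 :: real
  assume d: "0 < d1 \<and> d1 < 1 \<and> 0 < d2 \<and> d2 < 1"
  define T where "T = Tset d1 d2"
  define A where "A = {- (pi / 2 - d1)..pi / 2 - d1}"
  have "0 < Re y" if "y \<in> T" for y
    using Re_pos_of_Tset d that unfolding T_def by blast
  hence lie: "zeros_poles_lie_on (udot k n) T (curves T k n)" if "1 \<le> n" for n
    using that by (intro zeros_poles_lie_on_curves)
  obtain C N where arcs: "\<And>n. N \<le> n \<Longrightarrow> ordered_parallel_arcs vfun right_eyebrow cis A
      (C * ln (real n) / real n) (C / real n) (map snd (curves T k n))"
    using curves_ordered_parallel[of d1 d2 k] d unfolding T_def A_def by blast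
  have "map snd (reflect_curves cs) = map ((`) uminus) (map snd cs)" for cs
    by (simp add: reflect_curves_def case_prod_unfold)
  hence "ordered_parallel_arcs (\<lambda>y. vfun (- y)) (uminus ` right_eyebrow) (\<lambda>t. - cis t) A
      (C * ln (real n) / real n) (C / real n) (map snd (reflect_curves (curves T k n)))"
    if "N \<le> n" for n
    using ordered_parallel_arcs_uminus[OF arcs[OF that]] by simp
  with arcs show "let T = Tset d1 d2; A = {- (pi / 2 - d1)..pi / 2 - d1} in
      (\<forall>n\<ge>1.
         length (curves T k n) = 4 * k + 2
       \<and> zeros_poles_lie_on (udot k n) T (curves T k n)
       \<and> zeros_poles_lie_on (reflect_pieces (udot k n)) (uminus ` T)
           (reflect_curves (curves T k n)))
    \<and> (\<exists>C N. \<forall>n\<ge>N.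
         ordered_parallel_arcs vfun right_eyebrow cis A
           (C * ln (real n) / real n) (C / real n) (map snd (curves T k n))
       \<and> ordered_parallel_arcs (\<lambda>y. vfun (- y)) (uminus ` right_eyebrow) (\<lambda>t. - cis t) A
           (C * ln (real n) / real n) (C / real n)
           (map snd (reflect_curves (curves T k n))))"
    unfolding Let_def T_def[symmetric] A_def[symmetric]
    using lie zeros_poles_lie_on_reflect length_curves by blast
qed simp

end
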